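(* Consider the simultaneous block-fading binary symmetric wiretap channel with parameters $q_1\in[0,1]$, $q_2=1-q_1$, and crossover probabilities satisfying $p_1\le p_2\le p_1^*\le p_2^*\le 0.5$. Its secrecy capacity with channel state information available only at the decoders is $$C^s_{\textrm{CSI-D}}= q_1[H(p_1^* )-H(p_1)]+q_2[H(p_2^* )-H(p_2)].$$
   Context: $H(p)=-p\log_2 p-(1-p)\log_2(1-p)$ is the binary entropy function, and BSC$(p)$ denotes the binary symmetric channel with crossover probability $p$. Simultaneous block-fading binary symmetric wiretap channel: the transmitter sends $NB$ binary symbols $X_{1:NB}$ organized in $B$ fading blocks of length $N$. Each block $k$ has a fading state $S_k\in\{1,2\}$, constant within the block, with $\Pr(S_k=1)=q_1$, $\Pr(S_k=2)=q_2$, states independent across blocks. Within block $k$, the legitimate receiver observes the output $Y$ of $N$ independent uses of BSC$(p_{S_k})$, and the eavesdropper observes the output $Z$ of $N$ independent uses of BSC$(p^*_{S_k})$ (same state for both). Let $\mathsf{S}=(S_1,\dots,S_B)$. A code consists of a (possibly randomized) encoder $X_{1:NB}=f(\mathsf{M})$ of a uniformly distributed message $\mathsf{M}$, which knows only the state distribution (not the realizations), and a decoder $\hat{\mathsf{M}}=g(Y_{1:NB},\mathsf{S})$ that knows the states; its rate is $\frac{1}{NB}\log_2$ of the message-set size. A rate $R$ is achievable if there are such codes of rate at least $R$ (asymptotically) with $N,B\to\infty$ such that $\Pr\{\mathsf{M}\ne\hat{\mathsf{M}}\}\to0$ and $\frac{1}{NB}I(\mathsf{M};Z_{1:NB}\mid\mathsf{S})\to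 0$. $C^s_{\textrm{CSI-D}}$ is the supremum of achievable rates. *)

theory Defs
  imports Complex_Main
begin

text \<open>Binary entropy function (with log 2 0 = 0, so 0 log 0 = 0).\<close>
definition bH :: "real \<Rightarrow> real" where
  "bH p = - p * log 2 p - (1 - p) * log 2 (1 - p)"

definition words :: "nat \<Rightarrow> bool list set" where
  "words L = {xs. length xs = L}"

definition states :: "nat \<Rightarrow> nat list set" where
  "states B = {s. length s = B \<and> set s \<subseteq> {1, 2}}"

definition state_prob :: "real \<Rightarrow> real \<Rightarrow> nat list \<Rightarrow> real" where
  "state_prob q1 q2 s = (\<Prod>b<length s. if s ! b = 1 then q1 else q2)"

text \<open>Block-fading BSC transition probability W(y|x,s): symbol i lies in block i div N,
  whose state is s!(i div N); pc j is the crossover probability in state j.\<close>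
definition bf_bsc :: "(nat \<Rightarrow> real) \<Rightarrow> nat \<Rightarrow> nat list \<Rightarrow> bool list \<Rightarrow> bool list \<Rightarrow> real" where
  "bf_bsc pc N s x y =
     (\<Prod>i<length x. if y ! i = x ! i then 1 - pc (s ! (i div N)) else pc (s ! (i div N)))"

text \<open>A (stochastic) encoder for M messages {0..<M}: enc m is a probability distribution
  on words of length N*B. It does not depend on the state realisation.\<close>
definition valid_encoder :: "nat \<Rightarrow> nat \<Rightarrow> nat \<Rightarrow> (nat \<Rightarrow> bool list \<Rightarrow> real) \<Rightarrow> bool" where
  "valid_encoder N B M enc \<longleftrightarrow> M \<ge> 1 \<and>
     (\<forall>m<M. (\<forall>x. 0 \<le> enc m x) \<and> (\<Sum>x\<in>words (N * B). enc m x) = 1)"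

definition err_prob ::
  "real \<Rightarrow> real \<Rightarrow> (nat \<Rightarrow> real) \<Rightarrow> nat \<Rightarrow> nat \<Rightarrow> nat \<Rightarrow>
   (nat \<Rightarrow> bool list \<Rightarrow> real) \<Rightarrow> (bool list \<Rightarrow> nat list \<Rightarrow> nat) \<Rightarrow> real" where
  "err_prob q1 q2 pc N B M enc dec =
     (\<Sum>s\<in>states B. state_prob q1 q2 s *
        ((1 / real M) * (\<Sum>m<M. \<Sum>x\<in>words (N * B). enc m x *
           (\<Sum>y\<in>words (N * B). bf_bsc pc N s x y * (if dec y s \<noteq> m then 1 else 0)))))"

definition joint_MZ ::
  "(nat \<Rightarrow> real) \<Rightarrow> nat \<Rightarrow> nat \<Rightarrow> nat \<Rightarrow> (nat \<Rightarrow> bool list \<Rightarrow> real) \<Rightarrow>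
   nat list \<Rightarrow> nat \<Rightarrow> bool list \<Rightarrow> real" where
  "joint_MZ pce N B M enc s m z =
     (1 / real M) * (\<Sum>x\<in>words (N * B). enc m x * bf_bsc pce N s x z)"

definition leakage ::
  "real \<Rightarrow> real \<Rightarrow> (nat \<Rightarrow> real) \<Rightarrow> nat \<Rightarrow> nat \<Rightarrow> nat \<Rightarrow>
   (nat \<Rightarrow> bool list \<Rightarrow> real) \<Rightarrow> real" where
  "leakage q1 q2 pce N B M enc =
     (\<Sum>s\<in>states B. state_prob q1 q2 s *
        (\<Sum>m<M. \<Sum>z\<in>words (N * B).
           let j = joint_MZ pce N B M enc s m z;
               pz = (\<Sum>m'<M. joint_MZ pce N B M enc s m' z)
           in if j = 0 then 0 else j * log 2 (j / ((1 / real M) * pz))))"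

definition sec_achievable ::
  "real \<Rightarrow> real \<Rightarrow> (nat \<Rightarrow> real) \<Rightarrow> (nat \<Rightarrow> real) \<Rightarrow> real \<Rightarrow> bool" where
  "sec_achievable q1 q2 pc pce R \<longleftrightarrow>
     (\<exists>(N :: nat \<Rightarrow> nat) (B :: nat \<Rightarrow> nat) (M :: nat \<Rightarrow> nat)
        (enc :: nat \<Rightarrow> nat \<Rightarrow> bool list \<Rightarrow> real) (dec :: nat \<Rightarrow> bool list \<Rightarrow> nat list \<Rightarrow> nat).
        filterlim N at_top sequentially \<and> filterlim B at_top sequentially \<and>
        (\<forall>k. valid_encoder (N k) (B k) (M k) (enc k)) \<and>
        (\<forall>\<epsilon>>0. eventually (\<lambda>k. log 2 (real (M k)) / real (N k * B k) \<ge> R - \<epsilon>) sequentially) \<and>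
        ((\<lambda>k. err_prob q1 q2 pc (N k) (B k) (M k) (enc k) (dec k)) \<longlonglongrightarrow> 0) \<and>
        ((\<lambda>k. leakage q1 q2 pce (N k) (B k) (M k) (enc k) / real (N k * B k)) \<longlonglongrightarrow> 0))"

definition sec_capacity_CSID ::
  "real \<Rightarrow> real \<Rightarrow> real \<Rightarrow> real \<Rightarrow> real \<Rightarrow> real \<Rightarrow> real" where
  "sec_capacity_CSID q1 q2 p1 p2 p1s p2s =
     Sup {R. sec_achievable q1 q2 (\<lambda>j. if j = 1 then p1 else p2)
                                  (\<lambda>j. if j = 1 then p1s else p2s) R}"

end

theory Submission
  imports Defs "HOL-Library.FuncSet"
begin

text \<open>
  Converse: in each state the eavesdropper's channel is the legitimate one followed by further binary
  symmetric noise. That noise can only raise the entropy of the output, and data processing bounds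
  \<open>H(Z|M) - H(Y|M)\<close> by \<open>H(Z|X) - H(Y|X)\<close>, so \<open>I(M;Y) - I(M;Z)\<close> is at most the sum of the entropy gaps
  of the symbols; Fano's inequality finishes the argument.

  Achievability: a random codebook indexed by a message and a randomisation index, with about
  \<open>2 powr (n (h' - h))\<close> messages and \<open>2 powr (n (1 - h'))\<close> randomisation indices, where \<open>h\<close>, \<open>h'\<close> are the
  state-averaged noise entropies. The receiver decodes both indices; an eavesdropper who is told the
  message can decode the other one, so by Fano nearly all of the at most \<open>n (1 - h')\<close> bits reaching
  the eavesdropper are spent on the randomisation.
\<close>

subsection \<open>Product weights on lists of fixed length\<close>

text \<open>One code has to serve every state sequence. Symmetry of the channels makes this
  possible: uniform codewords suit all states at once, and a decoder that knows the states can test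
  a codeword through the noise \<open>xor_word x y\<close> alone, against a typical set that varies
  with the states. Given the states, the noise information of N B symbols is a sum of that many
  independent terms, but its conditional mean is N times a sum over only B independent states.
  Chebyshev's inequality therefore gives atypicality of order 1/B, and it is the number of blocks
  that has to grow. One codebook must suit both receivers, so their failure probabilities are added
  before averaging over codebooks. Secrecy is measured per symbol: an index that is misidentified
  with probability \<open>\<eta>\<close> costs about \<open>\<eta> * log 2 L\<close> bits, which is
  at most 2 n \<open>\<eta>\<close>, so no particular speed of \<open>\<eta>\<close> tending to 0 is
  required.\<close>

definition lists_of :: "nat \<Rightarrow> 'a set \<Rightarrow> 'a list set" where
  "lists_of n A = {xs. length xs = n \<and> set xs \<subseteq> A}"

text \<open>A product law whose marginals may depend on the position. With alphabet
  \<open>UNIV\<close> it is the noise of a channel whose crossover probability varies, with alphabet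
  \<open>{1, 2}\<close> the law of the states, so moments are computed once for both.\<close>

definition prod_wt :: "nat \<Rightarrow> (nat \<Rightarrow> 'a \<Rightarrow> real) \<Rightarrow> 'a list \<Rightarrow> real" where
  "prod_wt n w xs = (\<Prod>i<n. w i (xs ! i))"

lemma words_eq_lists_of: "words n = lists_of n UNIV"
  by (simp add: words_def lists_of_def)

lemma states_eq_lists_of: "states B = lists_of B {1, 2}"
  by (simp add: states_def lists_of_def)

lemma finite_lists_of: "finite A \<Longrightarrow> finite (lists_of n A)"
  using finite_lists_length_eq[of A n] by (simp add: lists_of_def conj_commute)

lemma lists_of_length: "xs \<in> lists_of n A \<Longrightarrow> length xs = n"
  by (simp add: lists_of_def)

lemma lists_of_0: "lists_of 0 A = {[]}"
  by (auto simp: lists_of_def)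

text \<open>Splitting off the last entry and not the head leaves the positions of the others
  unchanged, so the position-dependent \<open>w i\<close> needs no index shift in the
  inductions.\<close>

lemma lists_of_Suc: "lists_of (Suc n) A = (\<lambda>(xs, a). xs @ [a]) ` (lists_of n A \<times> A)"
proof -
  have "xs \<in> (\<lambda>(xs, a). xs @ [a]) ` (lists_of n A \<times> A)" if "xs \<in> lists_of (Suc n) A" for xs
  proof -
    have "xs \<noteq> []" using that by (auto simp: lists_of_def)
    then have "xs = butlast xs @ [last xs]" by simp
    moreover have "butlast xs \<in> lists_of n A" "last xs \<in> A"
      using that \<open>xs \<noteq> []\<close> by (auto simp: lists_of_def dest: in_set_butlastD)
    ultimately show ?thesis by (metis (no_types, lifting) SigmaI case_prod_conv image_eqI)
  qed
  then show ?thesis by (auto simp: lists_of_def)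
qed

lemma sum_lists_of_Suc:
  "(\<Sum>xs\<in>lists_of (Suc n) A. F xs) = (\<Sum>xs\<in>lists_of n A. \<Sum>a\<in>A. F (xs @ [a]))"
proof -
  have "inj_on (\<lambda>(xs, a). xs @ [a]) (lists_of n A \<times> A)" by (auto simp: inj_on_def)
  then show ?thesis
    by (simp add: lists_of_Suc sum.reindex sum.cartesian_product comp_def case_prod_unfold)
qed

lemma prod_wt_snoc:
  "length xs = n \<Longrightarrow> prod_wt (Suc n) w (xs @ [a]) = prod_wt n w xs * w n a"
  by (auto simp: prod_wt_def nth_append intro!: prod.cong)

lemma sum_snoc:
  "length xs = n \<Longrightarrow> (\<Sum>i<Suc n. g i ((xs @ [a]) ! i)) = (\<Sum>i<n. g i (xs ! i)) + g n a"
  by (auto simp: nth_append intro!: sum.cong)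

lemma sum_prod_wt:
  "(\<Sum>xs\<in>lists_of n A. prod_wt n w xs) = (\<Prod>i<n. \<Sum>a\<in>A. w i a)"
proof (induction n)
  case 0
  show ?case by (simp add: lists_of_0 prod_wt_def)
next
  case (Suc n)
  have "(\<Sum>xs\<in>lists_of (Suc n) A. prod_wt (Suc n) w xs)
      = (\<Sum>xs\<in>lists_of n A. \<Sum>a\<in>A. prod_wt n w xs * w n a)"
    unfolding sum_lists_of_Suc
    by (intro sum.cong refl) (simp add: prod_wt_snoc lists_of_length)
  also have "\<dots> = (\<Sum>xs\<in>lists_of n A. prod_wt n w xs) * (\<Sum>a\<in>A. w n a)"
    by (simp only: sum_product)
  finally show ?case using Suc by simp
qed

lemma sum_prod_wt_eq_1:
  assumes "\<And>i. i < n \<Longrightarrow> (\<Sum>a\<in>A. w i a) = 1"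
  shows "(\<Sum>xs\<in>lists_of n A. prod_wt n w xs) = 1"
  using assms by (simp add: sum_prod_wt)

lemma mean_prod_wt:
  assumes "\<And>i. i < n \<Longrightarrow> (\<Sum>a\<in>A. w i a) = 1"
  shows "(\<Sum>xs\<in>lists_of n A. prod_wt n w xs * (\<Sum>i<n. g i (xs ! i)))
       = (\<Sum>i<n. \<Sum>a\<in>A. w i a * g i a)"
  using assms
proof (induction n)
  case 0
  show ?case by (simp add: lists_of_0)
next
  case (Suc n)
  have "(\<Sum>xs\<in>lists_of (Suc n) A. prod_wt (Suc n) w xs * (\<Sum>i<Suc n. g i (xs ! i)))
      = (\<Sum>xs\<in>lists_of n A. \<Sum>a\<in>A. prod_wt n w xs * (\<Sum>i<n. g i (xs ! i)) * w n a
          + prod_wt n w xs * (w n a * g n a))"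
    unfolding sum_lists_of_Suc
    by (intro sum.cong refl)
       (simp add: prod_wt_snoc sum_snoc lists_of_length algebra_simps del: sum.lessThan_Suc)
  also have "\<dots> = (\<Sum>xs\<in>lists_of n A. prod_wt n w xs * (\<Sum>i<n. g i (xs ! i))) * (\<Sum>a\<in>A. w n a)
      + (\<Sum>xs\<in>lists_of n A. prod_wt n w xs) * (\<Sum>a\<in>A. w n a * g n a)"
    by (simp only: sum.distrib sum_product)
  finally show ?case using Suc by (simp add: sum_prod_wt_eq_1)
qed

text \<open>Variances of independent centred terms add: expanding the square, each cross term
  contains the mean of the newest summand as a factor, and that is 0.\<close>

lemma second_moment_prod_wt:
  assumes "\<And>i. i < n \<Longrightarrow> (\<Sum>a\<in>A. w i a) = 1"
    and "\<And>i. i < n \<Longrightarrow> (\<Sum>a\<in>A. w i a * g i a) = 0"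
  shows "(\<Sum>xs\<in>lists_of n A. prod_wt n w xs * (\<Sum>i<n. g i (xs ! i))\<^sup>2)
       = (\<Sum>i<n. \<Sum>a\<in>A. w i a * (g i a)\<^sup>2)"
  using assms
proof (induction n)
  case 0
  show ?case by (simp add: lists_of_0)
next
  case (Suc n)
  have "(\<Sum>xs\<in>lists_of (Suc n) A. prod_wt (Suc n) w xs * (\<Sum>i<Suc n. g i (xs ! i))\<^sup>2)
      = (\<Sum>xs\<in>lists_of n A. \<Sum>a\<in>A. prod_wt n w xs * (\<Sum>i<n. g i (xs ! i))\<^sup>2 * w n a
          + (prod_wt n w xs * (2 * (\<Sum>i<n. g i (xs ! i)))) * (w n a * g n a)
          + prod_wt n w xs * (w n a * (g n a)\<^sup>2))"
    unfolding sum_lists_of_Suc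
    by (intro sum.cong refl)
       (simp add: prod_wt_snoc sum_snoc lists_of_length algebra_simps power2_eq_square
         del: sum.lessThan_Suc)
  also have "\<dots> = (\<Sum>xs\<in>lists_of n A. prod_wt n w xs * (\<Sum>i<n. g i (xs ! i))\<^sup>2) * (\<Sum>a\<in>A. w n a)
      + (\<Sum>xs\<in>lists_of n A. prod_wt n w xs * (2 * (\<Sum>i<n. g i (xs ! i)))) * (\<Sum>a\<in>A. w n a * g n a)
      + (\<Sum>xs\<in>lists_of n A. prod_wt n w xs) * (\<Sum>a\<in>A. w n a * (g n a)\<^sup>2)"
    by (simp only: sum.distrib sum_product)
  finally show ?case using Suc by (simp add: sum_prod_wt_eq_1)
qed

subsection \<open>Entropy inequalities\<close>

text \<open>Also applied to weights of total mass below 1, such as the slice of a joint law at one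
  message; \<open>ent_Times\<close> then adds the slices up to a joint entropy.\<close>

definition ent :: "'a set \<Rightarrow> ('a \<Rightarrow> real) \<Rightarrow> real" where
  "ent A f = - (\<Sum>x\<in>A. f x * log 2 (f x))"

text \<open>Source of all entropy inequalities here, from \<open>ln t \<le> t - 1\<close> at
  \<open>t = b x / a x\<close>. The hypothesis \<open>pos\<close> is absolute continuity: with
  \<open>log 2 0 = 0\<close> a vanishing \<open>b x\<close> would not be penalised. The reference
  \<open>b\<close> may have less mass than \<open>a\<close>, which \<open>fano\<close>
  exploits.\<close>

lemma gibbs:
  fixes a b :: "'a \<Rightarrow> real"
  assumes "\<And>x. x \<in> A \<Longrightarrow> 0 \<le> a x" "\<And>x. x \<in> A \<Longrightarrow> 0 \<le> b x"
    and pos: "\<And>x. x \<in> A \<Longrightarrow> 0 < a x \<Longrightarrow> 0 < b x"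
    and "sum b A \<le> sum a A"
  shows "0 \<le> (\<Sum>x\<in>A. a x * (log 2 (a x) - log 2 (b x)))"
proof -
  have "(a x - b x) / ln 2 \<le> a x * (log 2 (a x) - log 2 (b x))" if x: "x \<in> A" for x
  proof (cases "a x = 0")
    case True
    then show ?thesis using assms(2)[OF x] by (simp add: divide_nonpos_pos)
  next
    case False
    then have a: "0 < a x" and b: "0 < b x" using assms(1)[OF x] pos[OF x] by auto
    have "a x * ln (b x / a x) \<le> a x * (b x / a x - 1)"
      using a b by (intro mult_left_mono ln_le_minus_one) auto
    then have "a x - b x \<le> a x * (ln (a x) - ln (b x))"
      using a b by (simp add: ln_div algebra_simps)
    then show ?thesis
      by (simp add: log_def divide_right_mono flip: diff_divide_distrib)
  qed
  then have "(\<Sum>x\<in>A. (a x - b x) / ln 2) \<le> (\<Sum>x\<in>A. a x * (log 2 (a x) - log 2 (b x)))"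
    by (rule sum_mono)
  moreover have "0 \<le> (\<Sum>x\<in>A. (a x - b x) / ln 2)"
    using assms(4) by (simp add: sum_subtractf flip: sum_divide_distrib)
  ultimately show ?thesis by linarith
qed

lemma ent_le_log_card:
  assumes "finite A" "\<And>x. x \<in> A \<Longrightarrow> 0 \<le> f x" "sum f A = 1"
  shows "ent A f \<le> log 2 (card A)"
proof -
  have c: "0 < card A" using assms by (auto simp: card_gt_0_iff)
  have "0 \<le> (\<Sum>x\<in>A. f x * (log 2 (f x) - log 2 (1 / card A)))"
    by (rule gibbs) (use assms c in auto)
  also have "\<dots> = - ent A f + log 2 (card A)"
    using assms c by (simp add: ent_def log_divide right_diff_distrib sum_subtractf sum.distrib
        ring_distribs flip: sum_distrib_right) auto
  finally show ?thesis by simp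
qed

text \<open>The left side is the conditional entropy of the first component given the second. Gibbs
  is applied with the reference \<open>q z * t a z\<close>, where \<open>t\<close> puts mass 1/2 on
  the guess \<open>d z\<close> and spreads the other half uniformly. Then
  \<open>- log 2 (t a z)\<close> is 1 at the guess and \<open>1 + log 2 (card A)\<close> elsewhere,
  which averages to the bound.\<close>

lemma fano:
  fixes r :: "'a \<Rightarrow> 'z \<Rightarrow> real"
  assumes fin: "finite A" "finite Z" and "A \<noteq> {}"
    and r0: "\<And>a z. a \<in> A \<Longrightarrow> z \<in> Z \<Longrightarrow> 0 \<le> r a z"
    and r1: "(\<Sum>a\<in>A. \<Sum>z\<in>Z. r a z) = 1"
  shows "ent (A \<times> Z) (\<lambda>(a, z). r a z) - ent Z (\<lambda>z. \<Sum>a\<in>A. r a z)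
    \<le> 1 + (\<Sum>a\<in>A. \<Sum>z\<in>Z. r a z * (if d z \<noteq> a then 1 else 0)) * log 2 (card A)"
proof -
  define t where "t a z = (if d z = a then 1/2 else 1 / (2 * real (card A)))" for a z
  define q where "q z = (\<Sum>a\<in>A. r a z)" for z
  have c: "0 < card A" using assms by (auto simp: card_gt_0_iff)
  have t0: "0 < t a z" for a z using c by (simp add: t_def)
  have q0: "0 \<le> q z" if "z \<in> Z" for z using that r0 by (auto simp: q_def sum_nonneg)
  have qpos: "0 < q z" if "a \<in> A" "z \<in> Z" "0 < r a z" for a z
  proof -
    have "r a z \<le> q z" unfolding q_def
      using that r0 fin by (intro member_le_sum) auto
    with that show ?thesis by simp
  qed
  \<comment> \<open>Only an inequality: the guess takes no share of the uniform half, and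
    \<open>d z\<close> may lie outside \<open>A\<close>.\<close>
  have t1: "(\<Sum>a\<in>A. t a z) \<le> 1" for z
  proof -
    have "(\<Sum>a\<in>A. t a z) \<le> (\<Sum>a\<in>A. (if a = d z then 1/2 else 0) + 1 / (2 * real (card A)))"
      by (intro sum_mono) (auto simp: t_def)
    also have "\<dots> \<le> 1" using c fin by (simp add: sum.distrib)
    finally show ?thesis .
  qed
  have "(\<Sum>(a,z)\<in>A \<times> Z. q z * t a z) = (\<Sum>z\<in>Z. q z * (\<Sum>a\<in>A. t a z))"
    by (subst sum.cartesian_product[symmetric], subst sum.swap) (simp add: sum_distrib_left)
  also have "\<dots> \<le> (\<Sum>z\<in>Z. q z)"
    using q0 t1 by (intro sum_mono) (simp add: mult_left_le)
  also have "\<dots> = (\<Sum>(a,z)\<in>A \<times> Z. r a z)"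
    unfolding q_def by (subst sum.cartesian_product[symmetric], subst sum.swap) simp
  finally have le: "(\<Sum>(a,z)\<in>A \<times> Z. q z * t a z) \<le> (\<Sum>(a,z)\<in>A \<times> Z. r a z)" .
  have "0 \<le> (\<Sum>x\<in>A \<times> Z. (\<lambda>(a,z). r a z) x *
      (log 2 ((\<lambda>(a,z). r a z) x) - log 2 ((\<lambda>(a,z). q z * t a z) x)))"
    by (rule gibbs) (use r0 q0 t0 qpos le in \<open>auto simp: less_imp_le\<close>)
  also have "\<dots> = (\<Sum>a\<in>A. \<Sum>z\<in>Z. r a z * log 2 (r a z) - r a z * log 2 (q z)
      + (r a z + r a z * (if d z \<noteq> a then 1 else 0) * log 2 (card A)))"
    unfolding sum.cartesian_product
  proof (intro sum.cong refl, clarify)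
    fix a z assume az: "a \<in> A" "z \<in> Z"
    have t: "- log 2 (t a z) = 1 + (if d z \<noteq> a then 1 else 0) * log 2 (card A)"
      using c by (simp add: t_def log_divide log_mult)
    show "r a z * (log 2 (r a z) - log 2 (q z * t a z))
       = r a z * log 2 (r a z) - r a z * log 2 (q z)
      + (r a z + r a z * (if d z \<noteq> a then 1 else 0) * log 2 (card A))"
    proof (cases "r a z = 0")
      case False
      then have "0 < q z" using r0[OF az] qpos[OF az] by simp
      then have "log 2 (q z * t a z) = log 2 (q z) + log 2 (t a z)"
        using t0[of a z] by (simp add: log_mult)
      also have "\<dots> = log 2 (q z) - (1 + (if d z \<noteq> a then 1 else 0) * log 2 (card A))"
        using t by linarith
      finally show ?thesis by (simp only: ring_distribs mult_1_right)
    qed simp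
  qed
  also have "\<dots> = (\<Sum>a\<in>A. \<Sum>z\<in>Z. r a z * log 2 (r a z)) - (\<Sum>a\<in>A. \<Sum>z\<in>Z. r a z * log 2 (q z))
      + (1 + (\<Sum>a\<in>A. \<Sum>z\<in>Z. r a z * (if d z \<noteq> a then 1 else 0)) * log 2 (card A))"
    unfolding sum.distrib sum_subtractf r1 sum_distrib_right ..
  also have "(\<Sum>a\<in>A. \<Sum>z\<in>Z. r a z * log 2 (q z)) = (\<Sum>z\<in>Z. q z * log 2 (q z))"
    by (subst sum.swap) (simp add: q_def sum_distrib_right)
  also have "(\<Sum>a\<in>A. \<Sum>z\<in>Z. r a z * log 2 (r a z)) = - ent (A \<times> Z) (\<lambda>(a, z). r a z)"
    by (simp add: ent_def sum.cartesian_product case_prod_beta)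
  finally show ?thesis unfolding ent_def[of Z] q_def by linarith
qed

text \<open>Gibbs compares \<open>py y * V y z\<close> with \<open>pz z * V y z\<close>. The column
  sums give the second the same mass as the first, and \<open>V\<close> cancels in the quotient,
  leaving the difference of the two entropies.\<close>

lemma ent_doubly_stochastic:
  assumes fin: "finite Y" "finite Z"
    and py: "\<And>y. y \<in> Y \<Longrightarrow> 0 \<le> py y"
    and V0: "\<And>y z. y \<in> Y \<Longrightarrow> z \<in> Z \<Longrightarrow> 0 \<le> V y z"
    and V1: "\<And>y. y \<in> Y \<Longrightarrow> (\<Sum>z\<in>Z. V y z) = 1"
    and V2: "\<And>z. z \<in> Z \<Longrightarrow> (\<Sum>y\<in>Y. V y z) = 1"
  shows "ent Y py \<le> ent Z (\<lambda>z. \<Sum>y\<in>Y. py y * V y z)"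
proof -
  define pz where "pz z = (\<Sum>y\<in>Y. py y * V y z)" for z
  have pz0: "0 \<le> pz z" if "z \<in> Z" for z using that py V0 by (auto simp: pz_def intro!: sum_nonneg)
  have pzpos: "0 < pz z" if "y \<in> Y" "z \<in> Z" "0 < py y * V y z" for y z
  proof -
    have "py y * V y z \<le> pz z" unfolding pz_def
      using that py V0 fin by (intro member_le_sum) auto
    with that show ?thesis by simp
  qed
  have Vpos: "0 < V y z" if "y \<in> Y" "z \<in> Z" "0 < py y * V y z" for y z
    using that V0[of y z] by (cases "V y z = 0") auto
  have pypos: "0 < py y" if "y \<in> Y" "z \<in> Z" "0 < py y * V y z" for y z
    using that py[of y] by (cases "py y = 0") auto
  have "(\<Sum>(y,z)\<in>Y \<times> Z. pz z * V y z) = (\<Sum>z\<in>Z. pz z * (\<Sum>y\<in>Y. V y z))"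
    by (subst sum.cartesian_product[symmetric], subst sum.swap) (simp add: sum_distrib_left)
  also have "\<dots> = (\<Sum>(y,z)\<in>Y \<times> Z. py y * V y z)"
    by (subst sum.cartesian_product[symmetric], subst sum.swap) (simp add: V2 pz_def)
  finally have le: "(\<Sum>(y,z)\<in>Y \<times> Z. pz z * V y z) \<le> (\<Sum>(y,z)\<in>Y \<times> Z. py y * V y z)" by simp
  have "0 \<le> (\<Sum>x\<in>Y \<times> Z. (\<lambda>(y,z). py y * V y z) x *
      (log 2 ((\<lambda>(y,z). py y * V y z) x) - log 2 ((\<lambda>(y,z). pz z * V y z) x)))"
    by (rule gibbs) (use py V0 pz0 pzpos Vpos le in \<open>auto\<close>)
  also have "\<dots> = (\<Sum>y\<in>Y. \<Sum>z\<in>Z. py y * log 2 (py y) * V y z - py y * V y z * log 2 (pz z))"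
    unfolding sum.cartesian_product
  proof (intro sum.cong refl, clarify)
    fix y z assume yz: "y \<in> Y" "z \<in> Z"
    show "py y * V y z * (log 2 (py y * V y z) - log 2 (pz z * V y z))
       = py y * log 2 (py y) * V y z - py y * V y z * log 2 (pz z)"
    proof (cases "py y * V y z = 0")
      case False
      then have "0 < py y * V y z" using py[of y] V0[of y z] yz by (simp add: less_le)
      then have "0 < py y" "0 < V y z" "0 < pz z" using pypos Vpos pzpos yz by blast+
      then show ?thesis by (simp add: log_mult algebra_simps)
    qed auto
  qed
  also have "\<dots> = - ent Y py - (\<Sum>y\<in>Y. \<Sum>z\<in>Z. py y * V y z * log 2 (pz z))"
    by (simp add: ent_def sum_subtractf V1 flip: sum_distrib_left)
  also have "(\<Sum>y\<in>Y. \<Sum>z\<in>Z. py y * V y z * log 2 (pz z)) = - ent Z pz"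
    by (subst sum.swap) (simp add: ent_def pz_def sum_distrib_right)
  finally show ?thesis unfolding pz_def by linarith
qed

text \<open>This is \<open>I(X;Z) \<le> I(X;Y)\<close> for the Markov chain \<open>X \<rightarrow> Y \<rightarrow> Z\<close>, with the marginal
  entropies collected on the left.\<close>
lemma data_processing:
  assumes fin: "finite X" "finite Y" "finite Z"
    and u0: "\<And>x. x \<in> X \<Longrightarrow> 0 \<le> u x"
    and W0: "\<And>x y. x \<in> X \<Longrightarrow> y \<in> Y \<Longrightarrow> 0 \<le> W x y"
    and V0: "\<And>y z. y \<in> Y \<Longrightarrow> z \<in> Z \<Longrightarrow> 0 \<le> V y z"
    and V1: "\<And>y. y \<in> Y \<Longrightarrow> (\<Sum>z\<in>Z. V y z) = 1"
    and W': "\<And>x z. x \<in> X \<Longrightarrow> z \<in> Z \<Longrightarrow> W' x z = (\<Sum>y\<in>Y. W x y * V y z)"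
  shows "ent Z (\<lambda>z. \<Sum>x\<in>X. u x * W' x z) - ent Y (\<lambda>y. \<Sum>x\<in>X. u x * W x y)
       \<le> (\<Sum>x\<in>X. u x * (ent Z (W' x) - ent Y (W x)))"
proof -
  define py where "py y = (\<Sum>x\<in>X. u x * W x y)" for y
  define pz where "pz z = (\<Sum>x\<in>X. u x * W' x z)" for z
  define a where "a = (\<lambda>(x,y,z). u x * W x y * V y z)"
  \<comment> \<open>Here \<open>b\<close> has the same (X,Z) and (Y,Z) marginals as \<open>a\<close>
    but makes X and Y independent given Z. Gibbs then says I(X;Y|Z) \<ge> 0, which for a Markov
    chain is I(X;Y) - I(X;Z). The weight \<open>u\<close> is not normalised: it has mass
    \<open>1 / M\<close> where the lemma is applied.\<close>
  define b where "b = (\<lambda>(x,y,z). u x * W' x z * (py y * V y z) / pz z)"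
  have W'0: "0 \<le> W' x z" if "x \<in> X" "z \<in> Z" for x z
    using that W0 V0 by (auto simp: W' intro!: sum_nonneg)
  have py0: "0 \<le> py y" if "y \<in> Y" for y using that u0 W0 by (auto simp: py_def intro!: sum_nonneg)
  have pz0: "0 \<le> pz z" if "z \<in> Z" for z using that u0 W'0 by (auto simp: pz_def intro!: sum_nonneg)
  have pz_py: "pz z = (\<Sum>y\<in>Y. py y * V y z)" if "z \<in> Z" for z
  proof -
    have "pz z = (\<Sum>x\<in>X. \<Sum>y\<in>Y. u x * W x y * V y z)"
      using that by (simp add: pz_def W' sum_distrib_left mult.assoc)
    also have "\<dots> = (\<Sum>y\<in>Y. py y * V y z)"
      by (subst sum.swap) (simp add: py_def sum_distrib_right)
    finally show ?thesis .
  qed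
  have pos: "0 < u x \<and> 0 < W x y \<and> 0 < V y z \<and> 0 < W' x z \<and> 0 < py y \<and> 0 < pz z"
    if xyz: "x \<in> X" "y \<in> Y" "z \<in> Z" and ne: "a (x,y,z) \<noteq> 0" for x y z
  proof -
    have 1: "0 < u x" "0 < W x y" "0 < V y z"
      using ne xyz u0 W0 V0 by (auto simp: a_def less_le)
    have "W x y * V y z \<le> W' x z" unfolding W'[OF xyz(1,3)]
      using xyz fin W0 V0 by (intro member_le_sum[where f = "\<lambda>y. W x y * V y z"]) auto
    then have 2: "0 < W' x z" using 1 by (meson mult_pos_pos less_le_trans)
    have "u x * W x y \<le> py y" unfolding py_def
      using xyz fin u0 W0 by (intro member_le_sum[where f = "\<lambda>x. u x * W x y"]) auto
    then have 3: "0 < py y" using 1 by (meson mult_pos_pos less_le_trans)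
    have "u x * W' x z \<le> pz z" unfolding pz_def
      using xyz fin u0 W'0 by (intro member_le_sum[where f = "\<lambda>x. u x * W' x z"]) auto
    then have 4: "0 < pz z" using 1 2 by (meson mult_pos_pos less_le_trans)
    show ?thesis using 1 2 3 4 by simp
  qed
  have suma: "sum a (X \<times> Y \<times> Z) = sum pz Z"
  proof -
    have "sum a (X \<times> Y \<times> Z) = (\<Sum>x\<in>X. \<Sum>y\<in>Y. \<Sum>z\<in>Z. u x * W x y * V y z)"
      by (simp add: a_def sum.cartesian_product)
    also have "\<dots> = (\<Sum>x\<in>X. \<Sum>z\<in>Z. \<Sum>y\<in>Y. u x * W x y * V y z)"
      by (intro sum.cong refl sum.swap)
    also have "\<dots> = (\<Sum>x\<in>X. \<Sum>z\<in>Z. u x * W' x z)"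
      by (simp add: W' sum_distrib_left mult.assoc)
    also have "\<dots> = sum pz Z" by (subst sum.swap) (simp add: pz_def)
    finally show ?thesis .
  qed
  have sumb: "sum b (X \<times> Y \<times> Z) = sum pz Z"
  proof -
    have "sum b (X \<times> Y \<times> Z) = (\<Sum>x\<in>X. \<Sum>y\<in>Y. \<Sum>z\<in>Z. u x * W' x z * (py y * V y z) / pz z)"
      by (simp add: b_def sum.cartesian_product)
    also have "\<dots> = (\<Sum>x\<in>X. \<Sum>z\<in>Z. \<Sum>y\<in>Y. u x * W' x z * (py y * V y z) / pz z)"
      by (intro sum.cong refl sum.swap)
    also have "\<dots> = (\<Sum>x\<in>X. \<Sum>z\<in>Z. u x * W' x z * pz z / pz z)"
      by (simp add: pz_py flip: sum_distrib_left sum_divide_distrib)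
    also have "\<dots> = (\<Sum>z\<in>Z. pz z * pz z / pz z)"
      unfolding pz_def sum_distrib_right sum_divide_distrib by (rule sum.swap)
    finally show ?thesis by simp
  qed
  have "0 \<le> (\<Sum>t\<in>X \<times> Y \<times> Z. a t * (log 2 (a t) - log 2 (b t)))"
  proof (rule gibbs)
    fix t assume t: "t \<in> X \<times> Y \<times> Z"
    obtain x y z where [simp]: "t = (x,y,z)" by (cases t)
    show "0 \<le> a t" using t u0 W0 V0 by (simp add: a_def)
    show "0 \<le> b t" using t u0 W'0 V0 py0 pz0 by (simp add: b_def)
    show "0 < b t" if "0 < a t" using that pos[of x y z] t by (simp add: b_def)
  qed (simp add: suma sumb)
  also have "\<dots> = (\<Sum>x\<in>X. \<Sum>y\<in>Y. \<Sum>z\<in>Z. u x * W x y * V y z * log 2 (W x y)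
      - u x * W x y * V y z * log 2 (W' x z) - u x * W x y * V y z * log 2 (py y)
      + u x * W x y * V y z * log 2 (pz z))"
    unfolding sum.cartesian_product
  proof (intro sum.cong refl, clarify)
    fix x y z assume xyz: "x \<in> X" "y \<in> Y" "z \<in> Z"
    show "a (x,y,z) * (log 2 (a (x,y,z)) - log 2 (b (x,y,z))) = u x * W x y * V y z * log 2 (W x y)
      - u x * W x y * V y z * log 2 (W' x z) - u x * W x y * V y z * log 2 (py y)
      + u x * W x y * V y z * log 2 (pz z)"
    proof (cases "a (x,y,z) = 0")
      case False
      show ?thesis using pos[OF xyz False]
        by (simp add: a_def b_def log_mult log_divide algebra_simps)
    qed (auto simp: a_def)
  qed
  also have "\<dots> = (\<Sum>x\<in>X. \<Sum>y\<in>Y. \<Sum>z\<in>Z. u x * W x y * V y z * log 2 (W x y))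
      - (\<Sum>x\<in>X. \<Sum>y\<in>Y. \<Sum>z\<in>Z. u x * W x y * V y z * log 2 (W' x z))
      - (\<Sum>x\<in>X. \<Sum>y\<in>Y. \<Sum>z\<in>Z. u x * W x y * V y z * log 2 (py y))
      + (\<Sum>x\<in>X. \<Sum>y\<in>Y. \<Sum>z\<in>Z. u x * W x y * V y z * log 2 (pz z))"
    by (simp only: sum.distrib sum_subtractf)
  also have "(\<Sum>x\<in>X. \<Sum>y\<in>Y. \<Sum>z\<in>Z. u x * W x y * V y z * log 2 (W x y))
      = - (\<Sum>x\<in>X. u x * ent Y (W x))"
  proof -
    have "(\<Sum>x\<in>X. \<Sum>y\<in>Y. \<Sum>z\<in>Z. u x * W x y * V y z * log 2 (W x y))
        = (\<Sum>x\<in>X. \<Sum>y\<in>Y. u x * W x y * log 2 (W x y) * (\<Sum>z\<in>Z. V y z))"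
      unfolding sum_distrib_left by (simp add: mult_ac)
    then show ?thesis by (simp add: V1 ent_def sum_distrib_left sum_negf mult.assoc)
  qed
  also have "(\<Sum>x\<in>X. \<Sum>y\<in>Y. \<Sum>z\<in>Z. u x * W x y * V y z * log 2 (py y)) = - ent Y py"
  proof -
    have "(\<Sum>x\<in>X. \<Sum>y\<in>Y. \<Sum>z\<in>Z. u x * W x y * V y z * log 2 (py y))
        = (\<Sum>x\<in>X. \<Sum>y\<in>Y. u x * W x y * log 2 (py y) * (\<Sum>z\<in>Z. V y z))"
      unfolding sum_distrib_left by (simp add: mult_ac)
    also have "\<dots> = (\<Sum>x\<in>X. \<Sum>y\<in>Y. u x * W x y * log 2 (py y))" by (simp add: V1)
    also have "\<dots> = (\<Sum>y\<in>Y. py y * log 2 (py y))"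
      by (subst sum.swap) (simp add: py_def sum_distrib_right)
    finally show ?thesis by (simp add: ent_def)
  qed
  also have "(\<Sum>x\<in>X. \<Sum>y\<in>Y. \<Sum>z\<in>Z. u x * W x y * V y z * log 2 (W' x z))
      = - (\<Sum>x\<in>X. u x * ent Z (W' x))"
  proof -
    have "(\<Sum>x\<in>X. \<Sum>y\<in>Y. \<Sum>z\<in>Z. u x * W x y * V y z * log 2 (W' x z))
        = (\<Sum>x\<in>X. \<Sum>z\<in>Z. \<Sum>y\<in>Y. u x * log 2 (W' x z) * (W x y * V y z))"
      by (subst sum.swap[of _ Y]) (simp add: mult_ac)
    also have "\<dots> = (\<Sum>x\<in>X. \<Sum>z\<in>Z. u x * log 2 (W' x z) * W' x z)"
      by (simp add: W' sum_distrib_left)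
    also have "\<dots> = (\<Sum>x\<in>X. \<Sum>z\<in>Z. u x * (W' x z * log 2 (W' x z)))"
      by (simp add: mult_ac)
    finally show ?thesis by (simp add: ent_def sum_distrib_left sum_negf)
  qed
  also have "(\<Sum>x\<in>X. \<Sum>y\<in>Y. \<Sum>z\<in>Z. u x * W x y * V y z * log 2 (pz z)) = - ent Z pz"
  proof -
    have "(\<Sum>x\<in>X. \<Sum>y\<in>Y. \<Sum>z\<in>Z. u x * W x y * V y z * log 2 (pz z))
        = (\<Sum>x\<in>X. \<Sum>z\<in>Z. \<Sum>y\<in>Y. u x * log 2 (pz z) * (W x y * V y z))"
      by (subst sum.swap[of _ Y]) (simp add: mult_ac)
    also have "\<dots> = (\<Sum>x\<in>X. \<Sum>z\<in>Z. u x * log 2 (pz z) * W' x z)"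
      by (simp add: W' sum_distrib_left)
    also have "\<dots> = (\<Sum>x\<in>X. \<Sum>z\<in>Z. u x * W' x z * log 2 (pz z))"
      by (simp add: mult_ac)
    also have "\<dots> = (\<Sum>z\<in>Z. pz z * log 2 (pz z))"
      by (subst sum.swap) (simp add: pz_def sum_distrib_right)
    finally show ?thesis by (simp add: ent_def)
  qed
  finally show ?thesis
    unfolding py_def pz_def by (simp add: right_diff_distrib sum_subtractf)
qed

section \<open>Entropies of product laws and of joint laws\<close>

lemma log_prod_wt:
  assumes "prod_wt n w xs \<noteq> 0"
  shows "log 2 (prod_wt n w xs) = (\<Sum>i<n. log 2 (w i (xs ! i)))"
proof -
  have "w i (xs ! i) \<noteq> 0" if "i < n" for i
    using that assms by (auto simp: prod_wt_def)
  then show ?thesis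
    unfolding prod_wt_def log_def by (subst ln_prod) (auto simp: sum_divide_distrib)
qed

lemma ent_prod_wt:
  assumes w0: "\<And>i a. i < n \<Longrightarrow> a \<in> A \<Longrightarrow> 0 \<le> w i a"
    and w1: "\<And>i. i < n \<Longrightarrow> (\<Sum>a\<in>A. w i a) = 1"
  shows "ent (lists_of n A) (prod_wt n w) = (\<Sum>i<n. ent A (w i))"
proof -
  have "prod_wt n w xs * log 2 (prod_wt n w xs)
      = prod_wt n w xs * (\<Sum>i<n. log 2 (w i (xs ! i)))" if xs: "xs \<in> lists_of n A" for xs
    by (cases "prod_wt n w xs = 0") (simp_all add: log_prod_wt)
  then have "(\<Sum>xs\<in>lists_of n A. prod_wt n w xs * log 2 (prod_wt n w xs))
      = (\<Sum>xs\<in>lists_of n A. prod_wt n w xs * (\<Sum>i<n. log 2 (w i (xs ! i))))"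
    by (rule sum.cong[OF refl])
  also have "\<dots> = (\<Sum>i<n. \<Sum>a\<in>A. w i a * log 2 (w i a))"
    by (rule mean_prod_wt) (rule w1)
  finally show ?thesis by (simp add: ent_def sum_negf)
qed

lemma ent_Times:
  "ent (A \<times> Z) (\<lambda>(a, z). f a z) = (\<Sum>a\<in>A. ent Z (f a))"
  by (simp add: ent_def sum.cartesian_product case_prod_unfold sum_negf)

text \<open>I = H(M) + H(Z) - H(M,Z) with \<open>log 2 M\<close> as the entropy of a uniform
  message; it brings the summand of \<open>leakage\<close> into a form that the entropy inequalities
  can bound.\<close>

lemma mutual_information_eq:
  fixes j :: "'m \<Rightarrow> 'z \<Rightarrow> real"
  assumes fin: "finite A" "finite Z" and M: "0 < M"
    and j0: "\<And>m z. m \<in> A \<Longrightarrow> z \<in> Z \<Longrightarrow> 0 \<le> j m z"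
    and j1: "(\<Sum>m\<in>A. \<Sum>z\<in>Z. j m z) = 1"
  shows "(\<Sum>m\<in>A. \<Sum>z\<in>Z. if j m z = 0 then 0
            else j m z * log 2 (j m z / ((1 / M) * (\<Sum>m'\<in>A. j m' z))))
       = log 2 M + ent Z (\<lambda>z. \<Sum>m\<in>A. j m z) - ent (A \<times> Z) (\<lambda>(m, z). j m z)"
proof -
  define q where "q z = (\<Sum>m\<in>A. j m z)" for z
  have "(\<Sum>m\<in>A. \<Sum>z\<in>Z. if j m z = 0 then 0 else j m z * log 2 (j m z / ((1 / M) * q z)))
      = (\<Sum>m\<in>A. \<Sum>z\<in>Z. j m z * log 2 (j m z) - j m z * log 2 (q z) + j m z * log 2 M)"
  proof (intro sum.cong refl)
    fix m z assume mz: "m \<in> A" "z \<in> Z"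
    show "(if j m z = 0 then 0 else j m z * log 2 (j m z / ((1 / M) * q z)))
        = j m z * log 2 (j m z) - j m z * log 2 (q z) + j m z * log 2 M"
    proof (cases "j m z = 0")
      case False
      then have p: "0 < j m z" using j0[OF mz] by simp
      have "j m z \<le> q z" unfolding q_def using mz j0 fin by (intro member_le_sum) auto
      with p have "0 < q z" by simp
      with p M show ?thesis by (simp add: log_mult log_divide algebra_simps)
    qed simp
  qed
  also have "\<dots> = (\<Sum>m\<in>A. \<Sum>z\<in>Z. j m z * log 2 (j m z)) - (\<Sum>m\<in>A. \<Sum>z\<in>Z. j m z * log 2 (q z))
      + (\<Sum>m\<in>A. \<Sum>z\<in>Z. j m z) * log 2 M"
    by (simp only: sum.distrib sum_subtractf sum_distrib_right)
  also have "(\<Sum>m\<in>A. \<Sum>z\<in>Z. j m z * log 2 (q z)) = - ent Z q"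
    by (subst sum.swap) (simp add: ent_def q_def sum_distrib_right)
  finally show ?thesis
    unfolding ent_Times q_def[abs_def] by (simp add: j1) (simp add: ent_def sum_negf)
qed

subsection \<open>Products of binary symmetric channels\<close>

text \<open>The crossover probability depends on the position: once the states are fixed, the fading
  channel is of this kind, and the blocks matter only through \<open>p\<close>.\<close>

definition bsc_wt :: "(nat \<Rightarrow> real) \<Rightarrow> bool list \<Rightarrow> nat \<Rightarrow> bool \<Rightarrow> real" where
  "bsc_wt p x i b = (if b = x ! i then 1 - p i else p i)"

abbreviation bsc :: "nat \<Rightarrow> (nat \<Rightarrow> real) \<Rightarrow> bool list \<Rightarrow> bool list \<Rightarrow> real" where
  "bsc n p x \<equiv> prod_wt n (bsc_wt p x)"

lemma finite_words: "finite (words n)"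
  by (simp add: words_eq_lists_of finite_lists_of)

lemma card_words: "card (words n) = 2 ^ n"
  using card_lists_length_eq[of "UNIV :: bool set" n] by (simp add: words_def)

lemma bsc_wt_sum: "(\<Sum>b\<in>UNIV. bsc_wt p x i b) = 1"
  by (simp add: bsc_wt_def UNIV_bool)

lemma bsc_wt_nonneg: "0 \<le> p i \<Longrightarrow> p i \<le> 1 \<Longrightarrow> 0 \<le> bsc_wt p x i b"
  by (simp add: bsc_wt_def)

lemma bsc_nonneg:
  assumes "\<And>i. i < n \<Longrightarrow> 0 \<le> p i \<and> p i \<le> 1"
  shows "0 \<le> bsc n p x y"
  unfolding prod_wt_def using assms by (auto intro!: prod_nonneg simp: bsc_wt_nonneg)

lemma bsc_sum: "(\<Sum>y\<in>words n. bsc n p x y) = 1"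
  unfolding words_eq_lists_of by (rule sum_prod_wt_eq_1) (rule bsc_wt_sum)

lemma bsc_sym: "bsc n p x y = bsc n p y x"
  unfolding prod_wt_def bsc_wt_def by (intro prod.cong) auto

text \<open>By symmetry the channel matrix is doubly stochastic, as
  \<open>ent_doubly_stochastic\<close> demands.\<close>

lemma bsc_sum_left: "(\<Sum>x\<in>words n. bsc n p x y) = 1"
  by (subst bsc_sym) (rule bsc_sum)

lemma ent_bsc_wt: "ent UNIV (bsc_wt p x i) = bH (p i)"
  by (simp add: ent_def bsc_wt_def UNIV_bool bH_def)

lemma ent_bsc:
  assumes "\<And>i. i < n \<Longrightarrow> 0 \<le> p i \<and> p i \<le> 1"
  shows "ent (words n) (bsc n p x) = (\<Sum>i<n. bH (p i))"
  unfolding words_eq_lists_of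
  by (subst ent_prod_wt) (use assms in \<open>auto simp: bsc_wt_nonneg bsc_wt_sum ent_bsc_wt\<close>)

text \<open>Symmetry turns the second factor into a weight of the intermediate word
  \<open>y\<close>, so the sum over \<open>y\<close> factorises over the positions and the claim is
  about single bits.\<close>

lemma bsc_cascade:
  assumes "\<And>i. i < n \<Longrightarrow> p' i = p i * (1 - a i) + (1 - p i) * a i"
  shows "bsc n p' x z = (\<Sum>y\<in>words n. bsc n p x y * bsc n a y z)"
proof -
  have "(\<Sum>y\<in>words n. bsc n p x y * bsc n a y z)
      = (\<Sum>y\<in>lists_of n UNIV. prod_wt n (\<lambda>i b. bsc_wt p x i b * bsc_wt a z i b) y)"
    unfolding words_eq_lists_of bsc_sym[of n a _ z] by (simp add: prod_wt_def prod.distrib)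
  also have "\<dots> = (\<Prod>i<n. \<Sum>b\<in>UNIV. bsc_wt p x i b * bsc_wt a z i b)"
    by (rule sum_prod_wt)
  also have "\<dots> = bsc n p' x z"
    unfolding prod_wt_def
    by (intro prod.cong refl) (auto simp: bsc_wt_def UNIV_bool assms algebra_simps)
  finally show ?thesis by simp
qed

text \<open>The equation is linear in \<open>a\<close>, namely
  \<open>p' = p + a * (1 - 2 * p)\<close>. It degenerates at \<open>p = 1 / 2\<close>, but then also
  \<open>p' = 1 / 2\<close> and no further noise is needed.\<close>

lemma degrading_parameter:
  fixes p p' :: real
  assumes "0 \<le> p" "p \<le> p'" "p' \<le> 1 / 2"
  obtains a where "0 \<le> a" "a \<le> 1" "p' = p * (1 - a) + (1 - p) * a"
proof (cases "p = 1 / 2")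
  case True
  then show ?thesis using assms that[of 0] by auto
next
  case False
  then have p: "0 < 1 - 2 * p" using assms by auto
  show ?thesis
  proof (rule that[of "(p' - p) / (1 - 2 * p)"])
    show "p' = p * (1 - (p' - p) / (1 - 2 * p)) + (1 - p) * ((p' - p) / (1 - 2 * p))"
      using p by (simp add: divide_simps) (simp add: algebra_simps)
  qed (use assms p in auto)
qed

lemma bH_le_1: assumes "0 \<le> p" "p \<le> 1" shows "bH p \<le> 1"
proof -
  have "ent UNIV (bsc_wt (\<lambda>_. p) [True] 0) \<le> log 2 (card (UNIV :: bool set))"
    by (rule ent_le_log_card) (use assms in \<open>auto simp: bsc_wt_nonneg bsc_wt_sum\<close>)
  then show ?thesis by (simp add: ent_bsc_wt)
qed

lemma bH_nonneg: assumes "0 \<le> p" "p \<le> 1" shows "0 \<le> bH p"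
proof -
  have "p * log 2 p \<le> 0" "(1 - p) * log 2 (1 - p) \<le> 0"
    using assms by (cases "p = 0"; cases "p = 1"; simp add: mult_nonneg_nonpos)+
  then show ?thesis by (simp add: bH_def)
qed

text \<open>Instead of differentiating, the larger parameter is reached by adding doubly stochastic
  noise to a single bit, which cannot lower the entropy.\<close>

lemma bH_mono:
  assumes "0 \<le> p" "p \<le> p'" "p' \<le> 1 / 2"
  shows "bH p \<le> bH p'"
proof -
  obtain a where a: "0 \<le> a" "a \<le> 1" "p' = p * (1 - a) + (1 - p) * a"
    using degrading_parameter[OF assms] .
  have "ent (words 1) (bsc 1 (\<lambda>_. p) [True])
      \<le> ent (words 1) (\<lambda>z. \<Sum>y\<in>words 1. bsc 1 (\<lambda>_. p) [True] y * bsc 1 (\<lambda>_. a) y z)"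
    using assms a
    by (intro ent_doubly_stochastic) (auto simp: finite_words bsc_nonneg bsc_sum bsc_sum_left)
  also have "\<dots> = ent (words 1) (bsc 1 (\<lambda>_. p') [True])"
    by (subst bsc_cascade[of 1 "\<lambda>_. p'" "\<lambda>_. p" "\<lambda>_. a", symmetric]) (use a in auto)
  finally show ?thesis using assms by (simp add: ent_bsc)
qed

text \<open>The bracket containing \<open>log 2 M\<close> is I(M;Z), so the claim bounds the
  eavesdropper's equivocation H(M,Z) - H(Z). It is the sum of three estimates: Fano for H(M,Y) -
  H(Y), then H(Y) \<le> H(Z), and a bound on H(M,Z) - H(M,Y) by the noise gaps.\<close>

lemma converse_fixed_state:
  fixes p p' :: "nat \<Rightarrow> real" and enc :: "nat \<Rightarrow> bool list \<Rightarrow> real"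
  assumes p: "\<And>i. i < n \<Longrightarrow> 0 \<le> p i \<and> p i \<le> p' i \<and> p' i \<le> 1 / 2"
    and M: "1 \<le> M"
    and enc0: "\<And>m x. m < M \<Longrightarrow> 0 \<le> enc m x"
    and enc1: "\<And>m. m < M \<Longrightarrow> (\<Sum>x\<in>words n. enc m x) = 1"
  defines "jY \<equiv> \<lambda>m y. \<Sum>x\<in>words n. (1 / real M * enc m x) * bsc n p x y"
    and "jZ \<equiv> \<lambda>m z. \<Sum>x\<in>words n. (1 / real M * enc m x) * bsc n p' x z"
  shows "log 2 M \<le> 1 + (\<Sum>m<M. \<Sum>y\<in>words n. jY m y * (if d y \<noteq> m then 1 else 0)) * log 2 M
      + (log 2 M + ent (words n) (\<lambda>z. \<Sum>m<M. jZ m z) - ent ({..<M} \<times> words n) (\<lambda>(m, z). jZ m z))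
      + (\<Sum>i<n. bH (p' i) - bH (p i))"
proof -
  have "\<exists>a. 0 \<le> a \<and> a \<le> 1 \<and> p' i = p i * (1 - a) + (1 - p i) * a" if "i < n" for i
    using degrading_parameter[of "p i" "p' i"] p[OF that] by metis
  then obtain a where a: "\<And>i. i < n \<Longrightarrow> 0 \<le> a i \<and> a i \<le> 1 \<and> p' i = p i * (1 - a i) + (1 - p i) * a i"
    by metis
  have casc: "bsc n p' x z = (\<Sum>y\<in>words n. bsc n p x y * bsc n a y z)" for x z
    by (rule bsc_cascade) (use a in auto)
  have W0: "0 \<le> bsc n p x y" "0 \<le> bsc n a x y" for x y
    using p a by (force intro!: bsc_nonneg)+
  have jY0: "0 \<le> jY m y" if "m < M" for m y
    using that enc0 W0 by (auto simp: jY_def intro!: sum_nonneg)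
  have jY1: "(\<Sum>m<M. \<Sum>y\<in>words n. jY m y) = 1"
  proof -
    have "(\<Sum>y\<in>words n. jY m y) = 1 / real M" if "m < M" for m
      unfolding jY_def
      by (subst sum.swap) (simp add: bsc_sum enc1[OF that] flip: sum_distrib_left sum_divide_distrib)
    then show ?thesis using M by simp
  qed
  have fano: "ent ({..<M} \<times> words n) (\<lambda>(m, y). jY m y) - ent (words n) (\<lambda>y. \<Sum>m<M. jY m y)
    \<le> 1 + (\<Sum>m<M. \<Sum>y\<in>words n. jY m y * (if d y \<noteq> m then 1 else 0)) * log 2 (card {..<M})"
    by (rule fano) (use M jY0 jY1 in \<open>auto simp: finite_words\<close>)
  have jZ: "jZ m z = (\<Sum>y\<in>words n. jY m y * bsc n a y z)" for m z
    unfolding jZ_def jY_def casc sum_distrib_left sum_distrib_right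
    by (subst sum.swap) (simp add: mult_ac)
  have "ent (words n) (\<lambda>y. \<Sum>m<M. jY m y)
      \<le> ent (words n) (\<lambda>z. \<Sum>y\<in>words n. (\<Sum>m<M. jY m y) * bsc n a y z)"
    by (rule ent_doubly_stochastic)
       (use jY0 W0 in \<open>auto simp: finite_words bsc_sum bsc_sum_left intro!: sum_nonneg\<close>)
  also have "(\<lambda>z. \<Sum>y\<in>words n. (\<Sum>m<M. jY m y) * bsc n a y z) = (\<lambda>z. \<Sum>m<M. jZ m z)"
    unfolding jZ sum_distrib_right by (intro ext sum.swap)
  finally have ds: "ent (words n) (\<lambda>y. \<Sum>m<M. jY m y) \<le> ent (words n) (\<lambda>z. \<Sum>m<M. jZ m z)" .
  \<comment> \<open>Data processing conditional on the message: each \<open>m\<close> is treated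
    separately with input weight \<open>enc m x / M\<close>. The entropy of \<open>bsc\<close> given
    its input does not depend on that input, so the stochastic encoder averages out.\<close>
  have "ent (words n) (jZ m) - ent (words n) (jY m)
      \<le> (1 / real M) * (\<Sum>i<n. bH (p' i) - bH (p i))" if m: "m < M" for m
  proof -
    have "ent (words n) (jZ m) - ent (words n) (jY m)
       \<le> (\<Sum>x\<in>words n. (1 / real M * enc m x) *
            (ent (words n) (bsc n p' x) - ent (words n) (bsc n p x)))"
      unfolding jZ_def jY_def
      by (rule data_processing[where V = "bsc n a"])
         (use enc0 m W0 casc in \<open>auto simp: finite_words bsc_sum\<close>)
    also have "\<dots> = (\<Sum>x\<in>words n. (1 / real M * enc m x) * (\<Sum>i<n. bH (p' i) - bH (p i)))"
    proof (intro sum.cong refl)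
      fix x
      have "ent (words n) (bsc n p' x) - ent (words n) (bsc n p x) = (\<Sum>i<n. bH (p' i) - bH (p i))"
        using p by (subst (1 2) ent_bsc) (force simp: sum_subtractf)+
      then show "(1 / real M * enc m x) * (ent (words n) (bsc n p' x) - ent (words n) (bsc n p x))
        = (1 / real M * enc m x) * (\<Sum>i<n. bH (p' i) - bH (p i))" by simp
    qed
    also have "\<dots> = (1 / real M) * (\<Sum>x\<in>words n. enc m x) * (\<Sum>i<n. bH (p' i) - bH (p i))"
      by (simp only: sum_distrib_left[of "1 / real M"] sum_distrib_right[of _ _ "\<Sum>i<n. bH (p' i) - bH (p i)"])
    finally show ?thesis by (simp add: enc1[OF m])
  qed
  then have "(\<Sum>m<M. ent (words n) (jZ m) - ent (words n) (jY m))
      \<le> (\<Sum>m<M. (1 / real M) * (\<Sum>i<n. bH (p' i) - bH (p i)))"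
    by (intro sum_mono) auto
  then have dpi: "ent ({..<M} \<times> words n) (\<lambda>(m, z). jZ m z) - ent ({..<M} \<times> words n) (\<lambda>(m, y). jY m y)
      \<le> (\<Sum>i<n. bH (p' i) - bH (p i))"
    using M by (simp add: ent_Times sum_subtractf)
  show ?thesis using fano ds dpi by simp
qed

subsection \<open>The block-fading channel\<close>

definition block_par :: "(nat \<Rightarrow> real) \<Rightarrow> nat \<Rightarrow> nat list \<Rightarrow> nat \<Rightarrow> real" where
  "block_par pc N s i = pc (s ! (i div N))"

definition state_wt :: "real \<Rightarrow> real \<Rightarrow> nat \<Rightarrow> nat \<Rightarrow> real" where
  "state_wt q1 q2 b j = (if j = 1 then q1 else q2)"

lemma bf_bsc_eq:
  "x \<in> words n \<Longrightarrow> bf_bsc pc N s x y = bsc n (block_par pc N s) x y"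
  unfolding bf_bsc_def words_def prod_wt_def bsc_wt_def block_par_def by simp

lemma state_prob_eq:
  "s \<in> states B \<Longrightarrow> state_prob q1 q2 s = prod_wt B (state_wt q1 q2) s"
  by (simp add: state_prob_def states_def prod_wt_def state_wt_def)

lemma finite_states: "finite (states B)"
  by (simp add: states_eq_lists_of finite_lists_of)

lemma state_prob_nonneg: "0 \<le> q1 \<Longrightarrow> 0 \<le> q2 \<Longrightarrow> 0 \<le> state_prob q1 q2 s"
  by (simp add: state_prob_def prod_nonneg)

lemma state_wt_sum: "(\<Sum>j\<in>{1, 2}. state_wt q1 q2 b j * g j) = q1 * g 1 + q2 * g 2"
  by (simp add: state_wt_def)

lemma state_prob_sum:
  assumes "q1 + q2 = 1"
  shows "(\<Sum>s\<in>states B. state_prob q1 q2 s) = 1"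
proof -
  have "(\<Sum>s\<in>states B. state_prob q1 q2 s) = (\<Sum>s\<in>states B. prod_wt B (state_wt q1 q2) s)"
    by (intro sum.cong) (auto simp: state_prob_eq)
  also have "\<dots> = 1" unfolding states_eq_lists_of
    by (rule sum_prod_wt_eq_1) (use assms state_wt_sum[of q1 q2 _ "\<lambda>_. 1"] in simp)
  finally show ?thesis .
qed

lemma state_mean:
  assumes "q1 + q2 = 1"
  shows "(\<Sum>s\<in>states B. state_prob q1 q2 s * (\<Sum>b<B. g (s ! b)))
       = real B * (q1 * g 1 + q2 * g 2)"
proof -
  have "(\<Sum>s\<in>states B. state_prob q1 q2 s * (\<Sum>b<B. g (s ! b)))
      = (\<Sum>s\<in>states B. prod_wt B (state_wt q1 q2) s * (\<Sum>b<B. g (s ! b)))"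
    by (intro sum.cong) (auto simp: state_prob_eq)
  also have "\<dots> = (\<Sum>b<B. \<Sum>j\<in>{1, 2}. state_wt q1 q2 b j * g j)"
    unfolding states_eq_lists_of
    by (rule mean_prod_wt) (use assms state_wt_sum[of q1 q2 _ "\<lambda>_. 1"] in simp)
  finally show ?thesis unfolding state_wt_sum by simp
qed

lemma sum_blocks:
  fixes f :: "nat \<Rightarrow> real"
  shows "(\<Sum>i<N * B. f (i div N)) = real N * (\<Sum>b<B. f b)"
proof -
  have "(\<Sum>i<N * B. f (i div N)) = (\<Sum>b<B. \<Sum>i=b * N..<b * N + N. f (i div N))"
    by (simp add: sum.nat_group mult.commute)
  also have "\<dots> = (\<Sum>b<B. \<Sum>i=b * N..<b * N + N. f b)"
  proof (intro sum.cong refl)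
    fix b i assume i: "i \<in> {b * N..<b * N + N}"
    then have "i div N = b" by (intro div_nat_eqI) (auto simp: mult.commute)
    then show "f (i div N) = f b" by simp
  qed
  finally show ?thesis by (simp add: sum_distrib_left)
qed

text \<open>Stated for an arbitrary predicate because it transfers both the range of the parameters
  and a bound on \<open>bvar\<close> from the two states to all positions.\<close>

lemma block_par_bounds:
  assumes s: "s \<in> states B" and P: "P (pc 1)" "P (pc 2)" and i: "i < N * B"
  shows "P (block_par pc N s i)"
proof -
  have "i div N < B" using i by (simp add: less_mult_imp_div_less mult.commute)
  then have "s ! (i div N) \<in> {1, 2}" using s by (auto simp: states_def subset_iff)
  then show ?thesis using P by (auto simp: block_par_def)
qed

lemma joint_MZ_eq:
  "joint_MZ pce N B M enc s m z
    = (\<Sum>x\<in>words (N * B). (1 / real M * enc m x) * bsc (N * B) (block_par pce N s) x z)"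
  by (simp add: joint_MZ_def bf_bsc_eq sum_divide_distrib)

lemma sum_joint_MZ:
  assumes "valid_encoder N B M enc"
  shows "(\<Sum>m<M. \<Sum>z\<in>words (N * B). joint_MZ pce N B M enc s m z) = 1"
proof -
  have "(\<Sum>z\<in>words (N * B). joint_MZ pce N B M enc s m z) = 1 / real M" if "m < M" for m
    unfolding joint_MZ_eq using that assms
    by (subst sum.swap)
       (simp add: bsc_sum valid_encoder_def flip: sum_distrib_left sum_divide_distrib)
  then show ?thesis using assms by (simp add: valid_encoder_def)
qed

lemma leakage_eq:
  assumes enc: "valid_encoder N B M enc"
    and pce: "0 \<le> pce 1" "pce 1 \<le> 1" "0 \<le> pce 2" "pce 2 \<le> 1"
  shows "leakage q1 q2 pce N B M enc = (\<Sum>s\<in>states B. state_prob q1 q2 s *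
     (log 2 M + ent (words (N * B)) (\<lambda>z. \<Sum>m<M. joint_MZ pce N B M enc s m z)
       - ent ({..<M} \<times> words (N * B)) (\<lambda>(m, z). joint_MZ pce N B M enc s m z)))"
  unfolding leakage_def Let_def
proof (intro sum.cong refl arg_cong2[where f = "(*)"])
  fix s assume s: "s \<in> states B"
  have "0 \<le> bsc (N * B) (block_par pce N s) x y" for x y
    by (rule bsc_nonneg) (use pce block_par_bounds[OF s, of "\<lambda>p. 0 \<le> p \<and> p \<le> 1"] in auto)
  then show "(\<Sum>m<M. \<Sum>z\<in>words (N * B). if joint_MZ pce N B M enc s m z = 0 then 0
         else joint_MZ pce N B M enc s m z * log 2 (joint_MZ pce N B M enc s m z /
            (1 / real M * (\<Sum>m'<M. joint_MZ pce N B M enc s m' z))))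
      = log 2 M + ent (words (N * B)) (\<lambda>z. \<Sum>m<M. joint_MZ pce N B M enc s m z)
       - ent ({..<M} \<times> words (N * B)) (\<lambda>(m, z). joint_MZ pce N B M enc s m z)"
    using enc
    by (intro mutual_information_eq sum_joint_MZ)
       (auto simp: finite_words joint_MZ_eq valid_encoder_def intro!: sum_nonneg)
qed

text \<open>Taken at \<open>pc\<close>, \<open>joint_MZ\<close> is the joint law of the message and
  the legitimate output, so reliability and leakage are expressed by one function.\<close>

lemma err_prob_eq:
  "err_prob q1 q2 pc N B M enc dec = (\<Sum>s\<in>states B. state_prob q1 q2 s *
     (\<Sum>m<M. \<Sum>y\<in>words (N * B). joint_MZ pc N B M enc s m y * (if dec y s \<noteq> m then 1 else 0)))"
  unfolding err_prob_def
proof (intro sum.cong refl arg_cong2[where f = "(*)"])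
  fix s
  have "1 / real M * (\<Sum>m<M. \<Sum>x\<in>words (N * B). enc m x *
           (\<Sum>y\<in>words (N * B). bf_bsc pc N s x y * (if dec y s \<noteq> m then 1 else 0)))
      = (\<Sum>m<M. \<Sum>x\<in>words (N * B). \<Sum>y\<in>words (N * B).
          1 / real M * (enc m x * bf_bsc pc N s x y) * (if dec y s \<noteq> m then 1 else 0))"
    unfolding sum_distrib_left by (simp add: mult.assoc)
  also have "\<dots> = (\<Sum>m<M. \<Sum>y\<in>words (N * B). \<Sum>x\<in>words (N * B).
          1 / real M * (enc m x * bf_bsc pc N s x y) * (if dec y s \<noteq> m then 1 else 0))"
    by (intro sum.cong refl sum.swap)
  also have "\<dots> = (\<Sum>m<M. \<Sum>y\<in>words (N * B). joint_MZ pc N B M enc s m y * (if dec y s \<noteq> m then 1 else 0))"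
    unfolding joint_MZ_def sum_distrib_left sum_distrib_right ..
  finally show "1 / real M * (\<Sum>m<M. \<Sum>x\<in>words (N * B). enc m x *
           (\<Sum>y\<in>words (N * B). bf_bsc pc N s x y * (if dec y s \<noteq> m then 1 else 0))) = \<dots>" .
qed

section \<open>Converse for the fading channel\<close>

lemma converse_finite_length:
  assumes q: "0 \<le> q1" "0 \<le> q2" "q1 + q2 = 1"
    and p: "0 \<le> pc 1" "pc 1 \<le> pce 1" "pce 1 \<le> 1 / 2" "0 \<le> pc 2" "pc 2 \<le> pce 2" "pce 2 \<le> 1 / 2"
    and enc: "valid_encoder N B M enc"
  shows "(1 - err_prob q1 q2 pc N B M enc dec) * log 2 M
    \<le> 1 + leakage q1 q2 pce N B M enc
      + real (N * B) * (q1 * (bH (pce 1) - bH (pc 1)) + q2 * (bH (pce 2) - bH (pc 2)))"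
proof -
  define \<pi> where "\<pi> = state_prob q1 q2"
  define Pe where "Pe s = (\<Sum>m<M. \<Sum>y\<in>words (N * B).
      joint_MZ pc N B M enc s m y * (if dec y s \<noteq> m then 1 else 0))" for s
  define Lk where "Lk s = log 2 M + ent (words (N * B)) (\<lambda>z. \<Sum>m<M. joint_MZ pce N B M enc s m z)
       - ent ({..<M} \<times> words (N * B)) (\<lambda>(m, z). joint_MZ pce N B M enc s m z)" for s
  \<comment> \<open>The fixed-state bound is used for each \<open>s\<close> with the decoder
    \<open>\<lambda>y. dec y s\<close>, which covers decoders that know the states. Its last term is
    a sum over blocks, so \<open>state_mean\<close> evaluates the average over
    \<open>s\<close>.\<close>
  have "log 2 M \<le> 1 + Pe s * log 2 M + Lk s + real N * (\<Sum>b<B. bH (pce (s ! b)) - bH (pc (s ! b)))"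
    if s: "s \<in> states B" for s
  proof -
    have "log 2 M \<le> 1 + Pe s * log 2 M + Lk s
        + (\<Sum>i<N * B. bH (block_par pce N s i) - bH (block_par pc N s i))"
      unfolding Pe_def Lk_def joint_MZ_eq
    proof (rule converse_fixed_state)
      fix i assume i: "i < N * B"
      then have "i div N < B" by (simp add: less_mult_imp_div_less mult.commute)
      then have "s ! (i div N) \<in> {1, 2}" using s by (auto simp: states_def subset_iff)
      then show "0 \<le> block_par pc N s i \<and> block_par pc N s i \<le> block_par pce N s i
          \<and> block_par pce N s i \<le> 1 / 2"
        using p by (auto simp: block_par_def)
    qed (use enc in \<open>auto simp: valid_encoder_def\<close>)
    also have "(\<Sum>i<N * B. bH (block_par pce N s i) - bH (block_par pc N s i))
        = real N * (\<Sum>b<B. bH (pce (s ! b)) - bH (pc (s ! b)))"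
      unfolding block_par_def by (rule sum_blocks)
    finally show ?thesis .
  qed
  then have "(\<Sum>s\<in>states B. \<pi> s * log 2 M) \<le> (\<Sum>s\<in>states B. \<pi> s *
      (1 + Pe s * log 2 M + Lk s + real N * (\<Sum>b<B. bH (pce (s ! b)) - bH (pc (s ! b)))))"
    using state_prob_nonneg[OF q(1,2)] by (intro sum_mono mult_left_mono) (auto simp: \<pi>_def)
  also have "\<dots> = (\<Sum>s\<in>states B. \<pi> s) + (\<Sum>s\<in>states B. \<pi> s * Pe s) * log 2 M
      + (\<Sum>s\<in>states B. \<pi> s * Lk s)
      + real N * (\<Sum>s\<in>states B. \<pi> s * (\<Sum>b<B. bH (pce (s ! b)) - bH (pc (s ! b))))"
    by (simp only: distrib_left sum.distrib sum_distrib_left sum_distrib_right mult_1_right)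
       (simp add: mult_ac)
  also have "(\<Sum>s\<in>states B. \<pi> s * log 2 M) = log 2 M"
    using state_prob_sum[OF q(3)] by (simp add: \<pi>_def flip: sum_distrib_right)
  also have "(\<Sum>s\<in>states B. \<pi> s * Pe s) = err_prob q1 q2 pc N B M enc dec"
    by (simp add: \<pi>_def Pe_def err_prob_eq)
  also have "(\<Sum>s\<in>states B. \<pi> s * Lk s) = leakage q1 q2 pce N B M enc"
    unfolding \<pi>_def Lk_def by (rule leakage_eq[symmetric]) (use enc p in auto)
  also have "(\<Sum>s\<in>states B. \<pi> s) = 1" using state_prob_sum[OF q(3)] by (simp add: \<pi>_def)
  also have "(\<Sum>s\<in>states B. \<pi> s * (\<Sum>b<B. bH (pce (s ! b)) - bH (pc (s ! b))))
      = real B * (q1 * (bH (pce 1) - bH (pc 1)) + q2 * (bH (pce 2) - bH (pc 2)))"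
    unfolding \<pi>_def by (rule state_mean) (rule q(3))
  finally show ?thesis by (simp add: algebra_simps)
qed

lemma converse_rate:
  assumes q: "0 \<le> q1" "0 \<le> q2" "q1 + q2 = 1"
    and p: "0 \<le> pc 1" "pc 1 \<le> pce 1" "pce 1 \<le> 1 / 2" "0 \<le> pc 2" "pc 2 \<le> pce 2" "pce 2 \<le> 1 / 2"
    and R: "sec_achievable q1 q2 pc pce R"
  shows "R \<le> q1 * (bH (pce 1) - bH (pc 1)) + q2 * (bH (pce 2) - bH (pc 2))" (is "R \<le> ?C")
proof -
  obtain N B M enc dec where N: "filterlim N at_top sequentially" and B: "filterlim B at_top sequentially"
    and enc: "\<And>k. valid_encoder (N k) (B k) (M k) (enc k)"
    and rate: "\<And>\<epsilon>. \<epsilon> > 0 \<Longrightarrow> eventually (\<lambda>k. log 2 (real (M k)) / real (N k * B k) \<ge> R - \<epsilon>) sequentially"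
    and err: "(\<lambda>k. err_prob q1 q2 pc (N k) (B k) (M k) (enc k) (dec k)) \<longlonglongrightarrow> 0"
    and leak: "(\<lambda>k. leakage q1 q2 pce (N k) (B k) (M k) (enc k) / real (N k * B k)) \<longlonglongrightarrow> 0"
    using R unfolding sec_achievable_def by blast
  define e where "e k = err_prob q1 q2 pc (N k) (B k) (M k) (enc k) (dec k)" for k
  define l where "l k = leakage q1 q2 pce (N k) (B k) (M k) (enc k) / real (N k * B k)" for k
  have nB: "filterlim (\<lambda>k. real (N k * B k)) at_top sequentially"
    unfolding of_nat_mult
    by (rule filterlim_at_top_mult_at_top[OF filterlim_compose[OF filterlim_real_sequentially N]
          filterlim_compose[OF filterlim_real_sequentially B]])
  have pos: "eventually (\<lambda>k. 0 < real (N k * B k)) sequentially"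
    using nB unfolding filterlim_at_top_dense by blast
  \<comment> \<open>The rates reach \<open>R\<close> only up to a slack, so the limit in
    \<open>k\<close> is taken for a fixed \<open>\<epsilon>\<close>, which is removed at the
    end.\<close>
  have bound: "R - \<epsilon> \<le> ?C" if \<epsilon>: "0 < \<epsilon>" for \<epsilon>
  proof -
    have "eventually (\<lambda>k. (1 - e k) * (R - \<epsilon>) \<le> 1 / real (N k * B k) + l k + ?C) sequentially"
      using rate[OF \<epsilon>] order_tendstoD(2)[OF err zero_less_one] pos
    proof (eventually_elim, goal_cases)
      case (1 k)
      \<comment> \<open>Keeping the factor \<open>1 - e k\<close> on the left avoids a division; its
        sign is settled by \<open>e k < 1\<close>, while \<open>R - \<epsilon>\<close> may be
        negative.\<close>
      have "(1 - e k) * (R - \<epsilon>) \<le> (1 - e k) * (log 2 (real (M k)) / real (N k * B k))"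
        using 1 by (intro mult_left_mono) (auto simp: e_def)
      also have "\<dots> = (1 - e k) * log 2 (real (M k)) / real (N k * B k)" by simp
      also have "\<dots> \<le> (1 + leakage q1 q2 pce (N k) (B k) (M k) (enc k) + real (N k * B k) * ?C) / real (N k * B k)"
        unfolding e_def using converse_finite_length[OF q p enc] by (intro divide_right_mono) auto
      also have "\<dots> = 1 / real (N k * B k) + l k + ?C"
        using 1(3) by (simp add: l_def add_divide_distrib del: of_nat_mult)
      finally show ?case .
    qed
    moreover have "(\<lambda>k. (1 - e k) * (R - \<epsilon>)) \<longlonglongrightarrow> (1 - 0) * (R - \<epsilon>)"
      using err unfolding e_def by (intro tendsto_mult tendsto_diff tendsto_const)
    moreover have "(\<lambda>k. 1 / real (N k * B k) + l k + ?C) \<longlonglongrightarrow> 0 + 0 + ?C"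
      using leak unfolding l_def
      by (rule tendsto_add[OF tendsto_add[OF tendsto_divide_0[OF tendsto_const
              filterlim_at_top_imp_at_infinity[OF nB]]] tendsto_const])
    ultimately have "(1 - 0) * (R - \<epsilon>) \<le> 0 + 0 + ?C"
      by (intro tendsto_le[OF trivial_limit_sequentially])
    then show ?thesis by simp
  qed
  show ?thesis
  proof (rule field_le_epsilon)
    show "R \<le> ?C + \<epsilon>" if "0 < \<epsilon>" for \<epsilon> using bound[OF that] by linarith
  qed
qed

subsection \<open>Random codebooks\<close>

text \<open>For an input \<open>x\<close> and an output \<open>y\<close> this is the noise added by
  the channel.\<close>

definition xor_word :: "bool list \<Rightarrow> bool list \<Rightarrow> bool list" where
  "xor_word x y = map2 (\<noteq>) x y"

abbreviation zero_word :: "nat \<Rightarrow> bool list" where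
  "zero_word n \<equiv> replicate n False"

lemma xor_word_in_words: "x \<in> words n \<Longrightarrow> y \<in> words n \<Longrightarrow> xor_word x y \<in> words n"
  by (simp add: words_def xor_word_def)

lemma xor_word_nth:
  "x \<in> words n \<Longrightarrow> y \<in> words n \<Longrightarrow> i < n \<Longrightarrow> xor_word x y ! i \<longleftrightarrow> x ! i \<noteq> y ! i"
  by (simp add: words_def xor_word_def)

lemma xor_word_cancel: "x \<in> words n \<Longrightarrow> y \<in> words n \<Longrightarrow> xor_word x (xor_word x y) = y"
  by (auto simp: words_def xor_word_def intro: nth_equalityI)

lemma xor_word_commute: "x \<in> words n \<Longrightarrow> y \<in> words n \<Longrightarrow> xor_word x y = xor_word y x"
  by (auto simp: words_def xor_word_def intro: nth_equalityI)

lemma bij_betw_xor_word: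
  assumes "x \<in> words n"
  shows "bij_betw (xor_word x) (words n) (words n)"
  by (rule bij_betw_byWitness[where f' = "xor_word x"])
     (use assms in \<open>auto simp: xor_word_cancel xor_word_in_words\<close>)

lemma bsc_eq_noise:
  assumes "x \<in> words n" "y \<in> words n"
  shows "bsc n p x y = bsc n p (zero_word n) (xor_word x y)"
  unfolding prod_wt_def bsc_wt_def
  using assms by (intro prod.cong refl) (auto simp: xor_word_nth)

text \<open>The noise is additive and independent of the input: translation by \<open>x\<close>
  permutes the words. Hence the chance of atypical noise is the same for every codeword and every
  codebook.\<close>

lemma sum_bsc_noise:
  assumes "x \<in> words n"
  shows "(\<Sum>y\<in>words n. bsc n p x y * g (xor_word x y)) = (\<Sum>e\<in>words n. bsc n p (zero_word n) e * g e)"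
proof -
  have "(\<Sum>y\<in>words n. bsc n p x y * g (xor_word x y))
      = (\<Sum>y\<in>words n. bsc n p (zero_word n) (xor_word x y) * g (xor_word x y))"
    by (intro sum.cong) (auto simp: bsc_eq_noise[OF assms])
  also have "\<dots> = (\<Sum>e\<in>words n. bsc n p (zero_word n) e * g e)"
    by (rule sum.reindex_bij_betw[OF bij_betw_xor_word[OF assms]])
  finally show ?thesis .
qed

lemma card_xor_word_le:
  assumes "y \<in> words n" "finite T"
  shows "card {w \<in> words n. xor_word w y \<in> T} \<le> card T"
proof (rule card_inj_on_le[where f = "xor_word y"])
  show "inj_on (xor_word y) {w \<in> words n. xor_word w y \<in> T}"
    using bij_betw_imp_inj_on[OF bij_betw_xor_word[OF assms(1)]] by (rule inj_on_subset) auto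
  show "xor_word y ` {w \<in> words n. xor_word w y \<in> T} \<subseteq> T"
    using xor_word_commute[OF assms(1)] by auto
qed (rule assms)

text \<open>Pairwise independence of random codewords in counting form. The average over codebooks
  is a finite sum over \<open>PiE\<close>; with all codewords except \<open>j\<close> held fixed,
  codeword \<open>j\<close> still runs through all of \<open>W\<close>, contributing at most
  \<open>b\<close> out of \<open>card W\<close> choices.\<close>

lemma sum_PiE_two_coordinates_le:
  fixes f :: "'a \<Rightarrow> 'a \<Rightarrow> real"
  assumes fin: "finite I" "finite W" "W \<noteq> {}" and jk: "j \<in> I" "k \<in> I" "j \<noteq> k"
    and f: "\<And>x. x \<in> W \<Longrightarrow> (\<Sum>w\<in>W. f x w) \<le> b"
  shows "(\<Sum>c\<in>PiE I (\<lambda>_. W). f (c k) (c j)) \<le> card (PiE I (\<lambda>_. W)) * (b / card W)"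
proof -
  define I' where "I' = I - {j}"
  have I: "I = insert j I'" "j \<notin> I'" "finite I'" "k \<in> I'" using jk fin by (auto simp: I'_def)
  have inj: "inj_on (\<lambda>(w, g). g(j := w)) (W \<times> PiE I' (\<lambda>_. W))"
    using inj_combinator[OF I(2), of "\<lambda>_. W"] by simp
  have "(\<Sum>c\<in>PiE I (\<lambda>_. W). f (c k) (c j)) = (\<Sum>w\<in>W. \<Sum>g\<in>PiE I' (\<lambda>_. W). f (g k) w)"
    unfolding I(1) PiE_insert_eq using inj jk(3)
    by (simp add: sum.reindex sum.cartesian_product case_prod_unfold)
  also have "\<dots> = (\<Sum>g\<in>PiE I' (\<lambda>_. W). \<Sum>w\<in>W. f (g k) w)" by (rule sum.swap)
  also have "\<dots> \<le> (\<Sum>g\<in>PiE I' (\<lambda>_. W). b)" using I(4) by (intro sum_mono f) auto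
  also have "\<dots> = card (PiE I (\<lambda>_. W)) * (b / card W)"
    using fin I by (simp add: I(1) card_PiE)
  finally show ?thesis .
qed

text \<open>Error probability of threshold decoding when codeword \<open>k\<close> is confusable only with the codewords
  in \<open>J k\<close>: all others for the legitimate receiver, those of the same message for the eavesdropper,
  who is told the message and only has to find the randomisation index.\<close>
definition decoding_cost ::
  "nat \<Rightarrow> 's set \<Rightarrow> ('s \<Rightarrow> real) \<Rightarrow> ('s \<Rightarrow> nat \<Rightarrow> real) \<Rightarrow> ('s \<Rightarrow> bool list set) \<Rightarrow> 'k set \<Rightarrow> ('k \<Rightarrow> 'k set)
    \<Rightarrow> ('k \<Rightarrow> bool list) \<Rightarrow> real" where
  "decoding_cost n S \<pi> p T I J c = (\<Sum>s\<in>S. \<pi> s * (\<Sum>k\<in>I. \<Sum>y\<in>words n. bsc n (p s) (c k) y *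
     (if xor_word (c k) y \<notin> T s \<or> (\<exists>j\<in>J k. xor_word (c j) y \<in> T s) then 1 else 0)) / card I)"

text \<open>Union bound averaged over all codebooks. Either the noise leaves \<open>T s\<close>, or
  one of at most \<open>Jm\<close> rivals passes the test; a rival is uniform and independent of the
  output, so it passes with probability at most \<open>\<tau> / 2 ^ n\<close>.\<close>

lemma sum_decoding_cost_le:
  fixes J :: "'k \<Rightarrow> 'k set"
  assumes fin: "finite I" "I \<noteq> {}" "finite S"
    and J: "\<And>k. k \<in> I \<Longrightarrow> J k \<subseteq> I - {k}" "\<And>k. k \<in> I \<Longrightarrow> real (card (J k)) \<le> Jm"
    and T: "\<And>s. s \<in> S \<Longrightarrow> finite (T s)" "\<And>s. s \<in> S \<Longrightarrow> real (card (T s)) \<le> \<tau>"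
    and \<pi>: "\<And>s. s \<in> S \<Longrightarrow> 0 \<le> \<pi> s" "sum \<pi> S = 1"
    and p: "\<And>s i. s \<in> S \<Longrightarrow> i < n \<Longrightarrow> 0 \<le> p s i \<and> p s i \<le> 1"
    and \<tau>: "0 \<le> \<tau>"
  shows "(\<Sum>c\<in>PiE I (\<lambda>_. words n). decoding_cost n S \<pi> p T I J c)
    \<le> card (PiE I (\<lambda>_. words n)) *
      ((\<Sum>s\<in>S. \<pi> s * (\<Sum>e\<in>words n. bsc n (p s) (zero_word n) e * (if e \<notin> T s then 1 else 0)))
       + Jm * \<tau> / 2 ^ n)"
    (is "_ \<le> real (card ?CB) * _")
proof -
  define bad where "bad s = (\<Sum>e\<in>words n. bsc n (p s) (zero_word n) e * (if e \<notin> T s then 1 else 0))" for s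
  define f where "f s x w = (\<Sum>y\<in>words n. bsc n (p s) x y * (if xor_word w y \<in> T s then 1 else 0))" for s x w
  have W0: "0 \<le> bsc n (p s) x y" if "s \<in> S" for s x y using p that by (intro bsc_nonneg) auto
  have Jm: "0 \<le> Jm" using J(2) fin(2) by (meson ex_in_conv of_nat_0_le_iff order_trans)
  \<comment> \<open>The rival \<open>w\<close> is summed before the output: for every fixed
    \<open>y\<close>, at most \<open>card (T s)\<close> words differ from it by an element of
    \<open>T s\<close>.\<close>
  have f_avg: "(\<Sum>w\<in>words n. f s x w) \<le> \<tau>" if s: "s \<in> S" for s x
  proof -
    have "(\<Sum>w\<in>words n. f s x w)
        = (\<Sum>y\<in>words n. bsc n (p s) x y * (\<Sum>w\<in>words n. if xor_word w y \<in> T s then 1 else 0))"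
      unfolding f_def sum_distrib_left by (rule sum.swap)
    also have "\<dots> \<le> (\<Sum>y\<in>words n. bsc n (p s) x y * \<tau>)"
    proof (intro sum_mono mult_left_mono W0 s)
      fix y :: "bool list" assume y: "y \<in> words n"
      have "(\<Sum>w\<in>words n. if xor_word w y \<in> T s then 1 else 0 :: real)
          = real (card {w \<in> words n. xor_word w y \<in> T s})"
        by (simp add: finite_words flip: sum.inter_filter)
      also have "\<dots> \<le> \<tau>" using card_xor_word_le[OF y T(1)[OF s]] T(2)[OF s] by linarith
      finally show "(\<Sum>w\<in>words n. if xor_word w y \<in> T s then 1 else 0 :: real) \<le> \<tau>" .
    qed
    also have "\<dots> = \<tau>" by (simp add: bsc_sum flip: sum_distrib_right)
    finally show ?thesis .
  qed
  have cost_le: "decoding_cost n S \<pi> p T I J c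
      \<le> (\<Sum>s\<in>S. \<pi> s * (\<Sum>k\<in>I. bad s + (\<Sum>j\<in>J k. f s (c k) (c j))) / card I)" if c: "c \<in> ?CB" for c
    unfolding decoding_cost_def
  proof (intro sum_mono mult_left_mono divide_right_mono \<pi>)
    fix s k assume s: "s \<in> S" and k: "k \<in> I"
    have ck: "c k \<in> words n" using c k by auto
    have finJ: "finite (J k)" using J(1)[OF k] fin(1) finite_subset by auto
    have "(\<Sum>y\<in>words n. bsc n (p s) (c k) y *
        (if xor_word (c k) y \<notin> T s \<or> (\<exists>j\<in>J k. xor_word (c j) y \<in> T s) then 1 else 0))
      \<le> (\<Sum>y\<in>words n. bsc n (p s) (c k) y * (if xor_word (c k) y \<notin> T s then 1 else 0)
          + (\<Sum>j\<in>J k. bsc n (p s) (c k) y * (if xor_word (c j) y \<in> T s then 1 else 0)))"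
    proof (rule sum_mono)
      fix y :: "bool list" assume "y \<in> words n"
      have "(if xor_word (c k) y \<notin> T s \<or> (\<exists>j\<in>J k. xor_word (c j) y \<in> T s) then 1 else 0)
        \<le> (if xor_word (c k) y \<notin> T s then 1 else 0)
          + (\<Sum>j\<in>J k. if xor_word (c j) y \<in> T s then 1 else 0 :: real)"
      proof (cases "\<exists>j\<in>J k. xor_word (c j) y \<in> T s")
        case True
        then obtain j where j: "j \<in> J k" "xor_word (c j) y \<in> T s" by blast
        have "(if xor_word (c j) y \<in> T s then 1 else 0 :: real)
            \<le> (\<Sum>j\<in>J k. if xor_word (c j) y \<in> T s then 1 else 0)"
          by (rule member_le_sum[where f = "\<lambda>j. if xor_word (c j) y \<in> T s then 1 else 0 :: real"])
             (use j finJ in auto)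
        with j show ?thesis by auto
      qed (auto intro: sum_nonneg)
      from mult_left_mono[OF this W0[OF s, of "c k" y]]
      show "bsc n (p s) (c k) y *
          (if xor_word (c k) y \<notin> T s \<or> (\<exists>j\<in>J k. xor_word (c j) y \<in> T s) then 1 else 0)
        \<le> bsc n (p s) (c k) y * (if xor_word (c k) y \<notin> T s then 1 else 0)
          + (\<Sum>j\<in>J k. bsc n (p s) (c k) y * (if xor_word (c j) y \<in> T s then 1 else 0))"
        by (simp only: distrib_left sum_distrib_left)
    qed
    also have "\<dots> = bad s + (\<Sum>j\<in>J k. f s (c k) (c j))"
      unfolding sum.distrib bad_def f_def
      using sum_bsc_noise[OF ck, of "p s" "\<lambda>e. if e \<notin> T s then 1 else 0"]
      by (subst sum.swap[of _ "J k"]) simp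
    finally show "(\<Sum>y\<in>words n. bsc n (p s) (c k) y *
        (if xor_word (c k) y \<notin> T s \<or> (\<exists>j\<in>J k. xor_word (c j) y \<in> T s) then 1 else 0))
      \<le> bad s + (\<Sum>j\<in>J k. f s (c k) (c j))" .
  qed auto
  have pair: "(\<Sum>c\<in>?CB. f s (c k) (c j)) \<le> card ?CB * (\<tau> / 2 ^ n)"
    if "s \<in> S" "k \<in> I" "j \<in> J k" for s k j
  proof -
    have "(\<Sum>c\<in>?CB. f s (c k) (c j)) \<le> card ?CB * (\<tau> / card (words n))"
      by (rule sum_PiE_two_coordinates_le)
         (use that J(1)[of k] fin f_avg card_words[of n] finite_words in \<open>auto simp: card_gt_0_iff\<close>)
    then show ?thesis by (simp add: card_words)
  qed
  have "(\<Sum>c\<in>?CB. decoding_cost n S \<pi> p T I J c)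
      \<le> (\<Sum>c\<in>?CB. \<Sum>s\<in>S. \<pi> s * (\<Sum>k\<in>I. bad s + (\<Sum>j\<in>J k. f s (c k) (c j))) / card I)"
    by (intro sum_mono cost_le)
  also have "\<dots> = (\<Sum>s\<in>S. \<pi> s * (\<Sum>k\<in>I. card ?CB * bad s + (\<Sum>j\<in>J k. \<Sum>c\<in>?CB. f s (c k) (c j))) / card I)"
  proof (subst sum.swap, intro sum.cong refl)
    fix s
    have "(\<Sum>c\<in>?CB. \<Sum>k\<in>I. bad s + (\<Sum>j\<in>J k. f s (c k) (c j)))
        = (\<Sum>k\<in>I. card ?CB * bad s + (\<Sum>j\<in>J k. \<Sum>c\<in>?CB. f s (c k) (c j)))"
      by (subst sum.swap) (simp add: sum.distrib sum.swap[of _ _ ?CB])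
    then show "(\<Sum>c\<in>?CB. \<pi> s * (\<Sum>k\<in>I. bad s + (\<Sum>j\<in>J k. f s (c k) (c j))) / card I)
       = \<pi> s * (\<Sum>k\<in>I. card ?CB * bad s + (\<Sum>j\<in>J k. \<Sum>c\<in>?CB. f s (c k) (c j))) / card I"
      by (simp flip: sum_distrib_left sum_divide_distrib)
  qed
  also have "\<dots> \<le> (\<Sum>s\<in>S. \<pi> s * (\<Sum>k\<in>I. card ?CB * bad s + card ?CB * (Jm * \<tau> / 2 ^ n)) / card I)"
  proof (intro sum_mono mult_left_mono divide_right_mono \<pi> add_left_mono)
    fix s k assume s: "s \<in> S" and k: "k \<in> I"
    have "(\<Sum>j\<in>J k. \<Sum>c\<in>?CB. f s (c k) (c j)) \<le> card (J k) * (card ?CB * (\<tau> / 2 ^ n))"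
      by (rule sum_bounded_above) (rule pair[OF s k])
    also have "\<dots> \<le> Jm * (card ?CB * (\<tau> / 2 ^ n))"
      using J(2)[OF k] \<tau> by (intro mult_right_mono) auto
    finally show "(\<Sum>j\<in>J k. \<Sum>c\<in>?CB. f s (c k) (c j)) \<le> card ?CB * (Jm * \<tau> / 2 ^ n)"
      by (simp add: mult_ac)
  qed auto
  also have "\<dots> = (\<Sum>s\<in>S. \<pi> s * (card ?CB * bad s + card ?CB * (Jm * \<tau> / 2 ^ n)))"
    using fin by (intro sum.cong refl) simp
  also have "\<dots> = card ?CB * (\<Sum>s\<in>S. \<pi> s * bad s) + card ?CB * (Jm * \<tau> / 2 ^ n) * sum \<pi> S"
    by (simp only: distrib_left sum.distrib sum_distrib_left sum_distrib_right) (simp add: mult_ac)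
  also have "\<dots> = card ?CB * ((\<Sum>s\<in>S. \<pi> s * bad s) + Jm * \<tau> / 2 ^ n)"
    by (simp add: \<pi>(2) distrib_left)
  finally show ?thesis unfolding bad_def .
qed

subsection \<open>Typical noise\<close>

text \<open>The input \<open>zero_word n\<close> turns \<open>bsc\<close> into the law of the noise.
  Only words that are too unlikely are excluded: a lower bound on each probability already limits
  their number, because the probabilities sum to 1.\<close>

definition typical_noise :: "nat \<Rightarrow> (nat \<Rightarrow> real) \<Rightarrow> real \<Rightarrow> bool list set" where
  "typical_noise n p t = {e \<in> words n. 2 powr (- t) \<le> bsc n p (zero_word n) e}"

lemma finite_typical_noise: "finite (typical_noise n p t)"
  by (simp add: typical_noise_def finite_words)

lemma card_typical_noise:
  assumes "\<And>i. i < n \<Longrightarrow> 0 \<le> p i \<and> p i \<le> 1"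
  shows "card (typical_noise n p t) \<le> 2 powr t"
proof -
  have "card (typical_noise n p t) * 2 powr (- t) \<le> (\<Sum>e\<in>typical_noise n p t. bsc n p (zero_word n) e)"
    by (rule sum_bounded_below) (simp add: typical_noise_def)
  also have "\<dots> \<le> (\<Sum>e\<in>words n. bsc n p (zero_word n) e)"
    by (rule sum_mono2) (use assms in \<open>auto simp: finite_words typical_noise_def bsc_nonneg\<close>)
  finally show ?thesis by (simp add: bsc_sum powr_minus field_simps)
qed

text \<open>Variance of the information content of one noise bit, whose mean is \<open>bH p\<close>.
  At the endpoints 0 and 1 it vanishes, owing to \<open>log 2 0 = 0\<close>.\<close>

definition bvar :: "real \<Rightarrow> real" where
  "bvar p = p * (- log 2 p - bH p)\<^sup>2 + (1 - p) * (- log 2 (1 - p) - bH p)\<^sup>2"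

lemma information_variance:
  "(\<Sum>e\<in>words n. bsc n p x e * (\<Sum>i<n. - log 2 (bsc_wt p x i (e ! i)) - bH (p i))\<^sup>2) = (\<Sum>i<n. bvar (p i))"
proof -
  have "(\<Sum>e\<in>words n. bsc n p x e * (\<Sum>i<n. (\<lambda>i b. - log 2 (bsc_wt p x i b) - bH (p i)) i (e ! i))\<^sup>2)
    = (\<Sum>i<n. \<Sum>b\<in>UNIV. bsc_wt p x i b * (- log 2 (bsc_wt p x i b) - bH (p i))\<^sup>2)"
    unfolding words_eq_lists_of
    by (rule second_moment_prod_wt) (auto simp: bsc_wt_def UNIV_bool bH_def algebra_simps)
  also have "\<dots> = (\<Sum>i<n. bvar (p i))"
    by (intro sum.cong refl) (auto simp: bsc_wt_def UNIV_bool bvar_def)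
  finally show ?thesis by simp
qed

text \<open>Chebyshev with two deviations: \<open>U\<close> of the noise information from its mean
  given the states, with variance of order N B, and \<open>N * D\<close> of that mean from
  \<open>n * h\<close>, with variance of order \<open>N\<^sup>2\<close> B. Dividing by
  \<open>(n * \<delta>)\<^sup>2\<close> leaves orders 1/(N B) and 1/B, both at most 1/B.\<close>

lemma atypical_noise_bound:
  assumes q: "0 \<le> q1" "0 \<le> q2" "q1 + q2 = 1"
    and pc: "0 \<le> pc 1" "pc 1 \<le> 1" "0 \<le> pc 2" "pc 2 \<le> 1"
    and \<delta>: "0 < \<delta>" and NB: "1 \<le> N" "1 \<le> B"
  defines "h \<equiv> q1 * bH (pc 1) + q2 * bH (pc 2)"
  shows "(\<Sum>s\<in>states B. state_prob q1 q2 s * (\<Sum>e\<in>words (N * B).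
      bsc (N * B) (block_par pc N s) (zero_word (N * B)) e *
      (if e \<notin> typical_noise (N * B) (block_par pc N s) (real (N * B) * (h + \<delta>)) then 1 else 0)))
    \<le> 2 * (bvar (pc 1) + bvar (pc 2) + q1 * (bH (pc 1) - h)\<^sup>2 + q2 * (bH (pc 2) - h)\<^sup>2) / \<delta>\<^sup>2 / real B"
proof -
  define n where "n = N * B"
  have n: "0 < n" using NB by (simp add: n_def)
  define P where "P s = bsc n (block_par pc N s) (zero_word n)" for s
  define U where "U s e = (\<Sum>i<n. - log 2 (bsc_wt (block_par pc N s) (zero_word n) i (e ! i))
      - bH (block_par pc N s i))" for s e
  define D where "D s = (\<Sum>b<B. bH (pc (s ! b)) - h)" for s
  define C where "C = bvar (pc 1) + bvar (pc 2)"
  define D2 where "D2 = q1 * (bH (pc 1) - h)\<^sup>2 + q2 * (bH (pc 2) - h)\<^sup>2"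
  have bv: "0 \<le> bvar x" if "0 \<le> x" "x \<le> 1" for x using that by (simp add: bvar_def)
  have P0: "0 \<le> P s e" if "s \<in> states B" for s e
    unfolding P_def n_def
    by (rule bsc_nonneg) (use pc block_par_bounds[OF that, of "\<lambda>p. 0 \<le> p \<and> p \<le> 1"] in auto)
  have term_le: "P s e * (if e \<notin> typical_noise n (block_par pc N s) (real n * (h + \<delta>)) then 1 else 0)
      \<le> P s e * ((2 * (U s e)\<^sup>2 + 2 * (real N * D s)\<^sup>2) / (real n * \<delta>)\<^sup>2)"
    if s: "s \<in> states B" and e: "e \<in> words n" for s e
  \<comment> \<open>Noise of probability 0 contributes nothing; it is set aside since its logarithm
    is 0 by convention and not very negative.\<close>
  proof (cases "P s e = 0 \<or> e \<in> typical_noise n (block_par pc N s) (real n * (h + \<delta>))")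
    case True
    then show ?thesis using P0[OF s, of e] by auto
  next
    case False
    then have Pe: "0 < P s e" using P0[OF s, of e] by auto
    have "P s e < 2 powr (- (real n * (h + \<delta>)))"
      using False e by (auto simp: typical_noise_def P_def)
    then have "log 2 (P s e) < - (real n * (h + \<delta>))" using Pe by (simp add: log_less_iff)
    then have "real n * (h + \<delta>) < (\<Sum>i<n. - log 2 (bsc_wt (block_par pc N s) (zero_word n) i (e ! i)))"
      using Pe by (simp add: P_def log_prod_wt sum_negf)
    also have "\<dots> = U s e + (\<Sum>i<n. bH (block_par pc N s i))"
      by (simp add: U_def sum_subtractf)
    also have "(\<Sum>i<n. bH (block_par pc N s i)) = real N * D s + real n * h"
      unfolding block_par_def n_def by (subst sum_blocks) (simp add: D_def sum_subtractf algebra_simps)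
    finally have "real n * \<delta> \<le> U s e + real N * D s" by (simp add: algebra_simps)
    then have "(real n * \<delta>)\<^sup>2 \<le> (U s e + real N * D s)\<^sup>2" using \<delta> by (intro power_mono) auto
    also have "\<dots> \<le> 2 * (U s e)\<^sup>2 + 2 * (real N * D s)\<^sup>2"
      using zero_le_power2[of "U s e - real N * D s"] by (simp add: power2_eq_square algebra_simps)
    finally have "1 \<le> (2 * (U s e)\<^sup>2 + 2 * (real N * D s)\<^sup>2) / (real n * \<delta>)\<^sup>2"
      using n \<delta> by (subst pos_le_divide_eq) auto
    from mult_left_mono[OF this P0[OF s, of e]] show ?thesis using False by auto
  qed
  have "(\<Sum>s\<in>states B. state_prob q1 q2 s * (\<Sum>e\<in>words n. P s e *
      (if e \<notin> typical_noise n (block_par pc N s) (real n * (h + \<delta>)) then 1 else 0)))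
    \<le> (\<Sum>s\<in>states B. state_prob q1 q2 s * (\<Sum>e\<in>words n. P s e *
        ((2 * (U s e)\<^sup>2 + 2 * (real N * D s)\<^sup>2) / (real n * \<delta>)\<^sup>2)))"
    using state_prob_nonneg[OF q(1,2)] by (intro sum_mono mult_left_mono term_le) auto
  also have "\<dots> \<le> (\<Sum>s\<in>states B. state_prob q1 q2 s *
      ((2 * (real n * C) + 2 * (real N * D s)\<^sup>2) / (real n * \<delta>)\<^sup>2))"
  proof (intro sum_mono mult_left_mono state_prob_nonneg q)
    fix s assume s: "s \<in> states B"
    have "(\<Sum>e\<in>words n. P s e * ((2 * (U s e)\<^sup>2 + 2 * (real N * D s)\<^sup>2) / (real n * \<delta>)\<^sup>2))
      = (2 * (\<Sum>e\<in>words n. P s e * (U s e)\<^sup>2) + 2 * (real N * D s)\<^sup>2 * (\<Sum>e\<in>words n. P s e)) / (real n * \<delta>)\<^sup>2"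
      by (simp only: sum_distrib_left sum_divide_distrib flip: sum.distrib)
         (simp add: algebra_simps)
    also have "(\<Sum>e\<in>words n. P s e) = 1" unfolding P_def by (rule bsc_sum)
    also have "(\<Sum>e\<in>words n. P s e * (U s e)\<^sup>2) = (\<Sum>i<n. bvar (block_par pc N s i))"
      unfolding P_def U_def by (rule information_variance)
    also have "(2 * (\<Sum>i<n. bvar (block_par pc N s i)) + 2 * (real N * D s)\<^sup>2 * 1) / (real n * \<delta>)\<^sup>2
      \<le> (2 * (real n * C) + 2 * (real N * D s)\<^sup>2) / (real n * \<delta>)\<^sup>2"
    proof (intro divide_right_mono)
      have "(\<Sum>i<n. bvar (block_par pc N s i)) \<le> (\<Sum>i<n. C)"
      proof (rule sum_mono)
        fix i assume "i \<in> {..<n}"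
        then show "bvar (block_par pc N s i) \<le> C"
          using block_par_bounds[OF s, of "\<lambda>p. bvar p \<le> C"] bv pc by (simp add: C_def n_def)
      qed
      then show "2 * (\<Sum>i<n. bvar (block_par pc N s i)) + 2 * (real N * D s)\<^sup>2 * 1
          \<le> 2 * (real n * C) + 2 * (real N * D s)\<^sup>2" by simp
    qed simp
    finally show "(\<Sum>e\<in>words n. P s e * ((2 * (U s e)\<^sup>2 + 2 * (real N * D s)\<^sup>2) / (real n * \<delta>)\<^sup>2))
      \<le> (2 * (real n * C) + 2 * (real N * D s)\<^sup>2) / (real n * \<delta>)\<^sup>2" .
  qed
  also have "\<dots> = (2 * (real n * C) * (\<Sum>s\<in>states B. state_prob q1 q2 s)
      + 2 * (real N)\<^sup>2 * (\<Sum>s\<in>states B. state_prob q1 q2 s * (D s)\<^sup>2)) / (real n * \<delta>)\<^sup>2"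
    by (simp only: sum_distrib_left sum_divide_distrib flip: sum.distrib)
       (simp add: power_mult_distrib algebra_simps)
  also have "(\<Sum>s\<in>states B. state_prob q1 q2 s) = 1" by (rule state_prob_sum[OF q(3)])
  also have "(\<Sum>s\<in>states B. state_prob q1 q2 s * (D s)\<^sup>2) = real B * D2"
  proof -
    have "(\<Sum>s\<in>states B. state_prob q1 q2 s * (D s)\<^sup>2)
      = (\<Sum>s\<in>lists_of B {1, 2}. prod_wt B (state_wt q1 q2) s * (\<Sum>b<B. (\<lambda>b j. bH (pc j) - h) b (s ! b))\<^sup>2)"
      unfolding D_def states_eq_lists_of[symmetric]
      by (rule sum.cong) (simp_all add: state_prob_eq)
    also have "\<dots> = (\<Sum>b<B. \<Sum>j\<in>{1, 2}. state_wt q1 q2 b j * (bH (pc j) - h)\<^sup>2)"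
    proof (rule second_moment_prod_wt)
      show "(\<Sum>j\<in>{1, 2}. state_wt q1 q2 b j) = 1" for b
        using state_wt_sum[of q1 q2 b "\<lambda>_. 1"] q(3) by simp
      have "q1 * (bH (pc 1) - h) + q2 * (bH (pc 2) - h) = h - (q1 + q2) * h"
        by (simp add: h_def algebra_simps)
      then show "(\<Sum>j\<in>{1, 2}. state_wt q1 q2 b j * (bH (pc j) - h)) = 0" for b
        unfolding state_wt_sum using q(3) by simp
    qed
    finally show ?thesis unfolding state_wt_sum by (simp add: D2_def)
  qed
  also have "(2 * (real n * C) * 1 + 2 * (real N)\<^sup>2 * (real B * D2)) / (real n * \<delta>)\<^sup>2
      = 2 * (C / real N + D2) / \<delta>\<^sup>2 / real B"
    using NB \<delta> by (simp add: n_def power2_eq_square divide_simps) (simp add: algebra_simps)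
  also have "\<dots> \<le> 2 * (C + D2) / \<delta>\<^sup>2 / real B"
  proof -
    have "0 \<le> C" using bv[OF pc(1,2)] bv[OF pc(3,4)] by (simp add: C_def)
    then have "C / real N \<le> C" using NB by (simp add: divide_le_eq mult_le_cancel_left1)
    then show ?thesis by (intro divide_right_mono mult_left_mono) auto
  qed
  finally show ?thesis unfolding P_def n_def C_def D2_def by (simp add: add.assoc)
qed

subsection \<open>Wiretap codes\<close>

text \<open>The random code bounds the leakage only from above, while convergence to 0 also asks for
  a lower bound. Gibbs is used with the reference \<open>q z / card A\<close>, which has the same
  mass as \<open>j\<close>.\<close>

lemma mutual_information_nonneg:
  fixes j :: "'m \<Rightarrow> 'z \<Rightarrow> real"
  assumes fin: "finite A" "finite Z"
    and j0: "\<And>m z. m \<in> A \<Longrightarrow> z \<in> Z \<Longrightarrow> 0 \<le> j m z"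
  shows "0 \<le> (\<Sum>m\<in>A. \<Sum>z\<in>Z. if j m z = 0 then 0
            else j m z * log 2 (j m z / ((1 / real (card A)) * (\<Sum>m'\<in>A. j m' z))))"
proof (cases "A = {}")
  case False
  then have cA: "0 < card A" using fin by (simp add: card_gt_0_iff)
  define q where "q z = (\<Sum>m\<in>A. j m z)" for z
  have q0: "0 \<le> q z" if "z \<in> Z" for z using that j0 by (auto simp: q_def sum_nonneg)
  have qpos: "0 < q z" if "m \<in> A" "z \<in> Z" "0 < j m z" for m z
  proof -
    have "j m z \<le> q z" unfolding q_def using that j0 fin by (intro member_le_sum) auto
    with that show ?thesis by simp
  qed
  have "(\<Sum>(m,z)\<in>A \<times> Z. (1 / real (card A)) * q z) = (\<Sum>z\<in>Z. q z)"
    using cA by (simp flip: sum.cartesian_product sum_divide_distrib)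
  also have "\<dots> = (\<Sum>(m,z)\<in>A \<times> Z. j m z)"
    unfolding q_def by (subst sum.cartesian_product[symmetric], rule sum.swap)
  finally have le: "(\<Sum>(m,z)\<in>A \<times> Z. (1 / real (card A)) * q z) \<le> (\<Sum>(m,z)\<in>A \<times> Z. j m z)" by simp
  have "0 \<le> (\<Sum>x\<in>A \<times> Z. (\<lambda>(m,z). j m z) x *
      (log 2 ((\<lambda>(m,z). j m z) x) - log 2 ((\<lambda>(m,z). (1 / real (card A)) * q z) x)))"
    by (rule gibbs) (use j0 q0 qpos cA le in auto)
  also have "\<dots> = (\<Sum>m\<in>A. \<Sum>z\<in>Z. if j m z = 0 then 0
            else j m z * log 2 (j m z / ((1 / real (card A)) * q z)))"
    unfolding sum.cartesian_product
  proof (intro sum.cong refl, clarify)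
    fix m z assume mz: "m \<in> A" "z \<in> Z"
    show "j m z * (log 2 (j m z) - log 2 (1 / real (card A) * q z)) = (if j m z = 0 then 0
            else j m z * log 2 (j m z / ((1 / real (card A)) * q z)))"
    proof (cases "j m z = 0")
      case False
      then have "0 < j m z" using j0[OF mz] by simp
      with qpos[OF mz] cA show ?thesis by (simp add: log_mult log_divide algebra_simps)
    qed simp
  qed
  finally show ?thesis unfolding q_def .
qed simp

lemma joint_MZ_nonneg:
  assumes enc: "valid_encoder N B M enc" and m: "m < M" and s: "s \<in> states B"
    and pce: "0 \<le> pce 1" "pce 1 \<le> 1" "0 \<le> pce 2" "pce 2 \<le> 1"
  shows "0 \<le> joint_MZ pce N B M enc s m z"
proof -
  have "0 \<le> bsc (N * B) (block_par pce N s) x z" for x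
    by (rule bsc_nonneg) (use pce block_par_bounds[OF s, of "\<lambda>p. 0 \<le> p \<and> p \<le> 1"] in auto)
  then show ?thesis using enc m by (auto simp: joint_MZ_eq valid_encoder_def intro!: sum_nonneg)
qed

lemma leakage_nonneg:
  assumes "valid_encoder N B M enc" "0 \<le> q1" "0 \<le> q2"
    and "0 \<le> pce 1" "pce 1 \<le> 1" "0 \<le> pce 2" "pce 2 \<le> 1"
  shows "0 \<le> leakage q1 q2 pce N B M enc"
  unfolding leakage_def Let_def
proof (rule sum_nonneg, rule mult_nonneg_nonneg)
  fix s assume s: "s \<in> states B"
  show "0 \<le> state_prob q1 q2 s" using assms by (intro state_prob_nonneg)
  show "0 \<le> (\<Sum>m<M. \<Sum>z\<in>words (N * B). if joint_MZ pce N B M enc s m z = 0 then 0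
         else joint_MZ pce N B M enc s m z * log 2 (joint_MZ pce N B M enc s m z /
            (1 / real M * (\<Sum>m'<M. joint_MZ pce N B M enc s m' z))))"
    using mutual_information_nonneg[of "{..<M}" "words (N * B)" "joint_MZ pce N B M enc s",
        unfolded card_lessThan] joint_MZ_nonneg[OF assms(1) _ s assms(4-)] finite_words
    by blast
qed

lemma err_prob_nonneg:
  assumes "valid_encoder N B M enc" "0 \<le> q1" "0 \<le> q2"
    and "0 \<le> pc 1" "pc 1 \<le> 1" "0 \<le> pc 2" "pc 2 \<le> 1"
  shows "0 \<le> err_prob q1 q2 pc N B M enc dec"
  unfolding err_prob_eq
  by (intro sum_nonneg mult_nonneg_nonneg state_prob_nonneg assms)
     (use assms joint_MZ_nonneg in auto)

text \<open>A uniform randomisation index selects the codeword. Summing over indices and not over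
  codewords adds up the masses of coinciding codewords, which a random codebook may contain.\<close>

definition code_enc :: "nat \<Rightarrow> (nat \<times> nat \<Rightarrow> bool list) \<Rightarrow> nat \<Rightarrow> bool list \<Rightarrow> real" where
  "code_enc L c m x = (\<Sum>l<L. if c (m, l) = x then 1 / real L else 0)"

lemma sum_code_enc:
  assumes "\<And>l. l < L \<Longrightarrow> c (m, l) \<in> words n"
  shows "(\<Sum>x\<in>words n. code_enc L c m x * g x) = (\<Sum>l<L. g (c (m, l)) / real L)"
proof -
  have "(\<Sum>x\<in>words n. code_enc L c m x * g x)
      = (\<Sum>l<L. \<Sum>x\<in>words n. (if c (m, l) = x then 1 / real L else 0) * g x)"
    unfolding code_enc_def sum_distrib_right by (rule sum.swap)
  also have "\<dots> = (\<Sum>l<L. \<Sum>x\<in>words n. if c (m, l) = x then g x / real L else 0)"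
    by (intro sum.cong refl) auto
  also have "\<dots> = (\<Sum>l<L. g (c (m, l)) / real L)"
    using assms by (intro sum.cong refl) (simp add: finite_words)
  finally show ?thesis .
qed

lemma valid_code_enc:
  assumes "1 \<le> M" "1 \<le> L" "c \<in> PiE ({..<M} \<times> {..<L}) (\<lambda>_. words (N * B))"
  shows "valid_encoder N B M (code_enc L c)"
  unfolding valid_encoder_def
proof (intro conjI allI impI assms)
  fix m assume "m < M"
  then have "(\<Sum>x\<in>words (N * B). code_enc L c m x * 1) = (\<Sum>l<L. 1 / real L)"
    using assms(3) by (intro sum_code_enc) auto
  then show "(\<Sum>x\<in>words (N * B). code_enc L c m x) = 1" using assms(2) by simp
qed (simp add: code_enc_def sum_nonneg)

lemma joint_MZ_code_enc:
  assumes "m < M" "c \<in> PiE ({..<M} \<times> {..<L}) (\<lambda>_. words (N * B))"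
  shows "joint_MZ pc N B M (code_enc L c) s m z
    = (\<Sum>l<L. 1 / (real M * real L) * bsc (N * B) (block_par pc N s) (c (m, l)) z)"
proof -
  have "joint_MZ pc N B M (code_enc L c) s m z = 1 / real M *
     (\<Sum>x\<in>words (N * B). code_enc L c m x * bsc (N * B) (block_par pc N s) x z)"
    by (simp add: joint_MZ_eq sum_divide_distrib)
  also have "\<dots> = 1 / real M * (\<Sum>l<L. bsc (N * B) (block_par pc N s) (c (m, l)) z / real L)"
    by (subst sum_code_enc) (use assms in auto)
  finally show ?thesis by (simp add: sum_distrib_left)
qed

lemma sum_Times: "(\<Sum>k\<in>A \<times> B. g k) = (\<Sum>a\<in>A. \<Sum>b\<in>B. g (a, b))"
  by (simp add: sum.cartesian_product)

lemma err_prob_code_enc_le: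
  fixes T :: "nat list \<Rightarrow> bool list set"
  assumes q: "0 \<le> q1" "0 \<le> q2"
    and pc: "0 \<le> pc 1" "pc 1 \<le> 1" "0 \<le> pc 2" "pc 2 \<le> 1"
    and c: "c \<in> PiE ({..<M} \<times> {..<L}) (\<lambda>_. words (N * B))"
  obtains dec where "err_prob q1 q2 pc N B M (code_enc L c) dec
    \<le> decoding_cost (N * B) (states B) (state_prob q1 q2) (block_par pc N) T
        ({..<M} \<times> {..<L}) (\<lambda>k. {..<M} \<times> {..<L} - {k}) c"
proof -
  define I where "I = {..<M} \<times> {..<L}"
  define fails where "fails s k y \<longleftrightarrow> xor_word (c k) y \<notin> T s \<or> (\<exists>j\<in>I - {k}. xor_word (c j) y \<in> T s)" for s k y
  have cI: "real (card I) = real M * real L" by (simp add: I_def card_cartesian_product)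
  \<comment> \<open>If the sent index passes the test and no other does, \<open>SOME\<close> is
    forced to return it. In every other case \<open>fails\<close> holds, whatever is
    returned.\<close>
  define dec where "dec y s = fst (SOME k. k \<in> I \<and> xor_word (c k) y \<in> T s)" for y s
  have dec: "fails s (m, l) y" if "m < M" "l < L" "dec y s \<noteq> m" for s m l y
  proof (rule ccontr)
    assume nf: "\<not> fails s (m, l) y"
    have "(SOME k. k \<in> I \<and> xor_word (c k) y \<in> T s) = (m, l)"
      by (rule some_equality) (use nf that in \<open>auto simp: fails_def I_def\<close>)
    then show False using that by (simp add: dec_def)
  qed
  have "err_prob q1 q2 pc N B M (code_enc L c) dec
     \<le> decoding_cost (N * B) (states B) (state_prob q1 q2) (block_par pc N) T I (\<lambda>k. I - {k}) c"
    unfolding err_prob_eq decoding_cost_def fails_def[symmetric] times_divide_eq_right[symmetric]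
  proof (intro sum_mono mult_left_mono state_prob_nonneg q)
    fix s assume s: "s \<in> states B"
    let ?w = "\<lambda>k y. bsc (N * B) (block_par pc N s) (c k) y"
    have W0: "0 \<le> ?w k y" for k y
      by (rule bsc_nonneg) (use pc block_par_bounds[OF s, of "\<lambda>p. 0 \<le> p \<and> p \<le> 1"] in auto)
    have "(\<Sum>m<M. \<Sum>y\<in>words (N * B). joint_MZ pc N B M (code_enc L c) s m y * (if dec y s \<noteq> m then 1 else 0))
        = (\<Sum>m<M. \<Sum>y\<in>words (N * B). \<Sum>l<L.
            1 / (real M * real L) * ?w (m, l) y * (if dec y s \<noteq> m then 1 else 0))"
      using c by (simp add: joint_MZ_code_enc sum_distrib_right)
    also have "\<dots> = (\<Sum>m<M. \<Sum>l<L. \<Sum>y\<in>words (N * B).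
            1 / (real M * real L) * ?w (m, l) y * (if dec y s \<noteq> m then 1 else 0))"
      by (intro sum.cong refl sum.swap)
    also have "\<dots> \<le> (\<Sum>m<M. \<Sum>l<L. \<Sum>y\<in>words (N * B).
            1 / (real M * real L) * ?w (m, l) y * (if fails s (m, l) y then 1 else 0))"
      using dec W0 by (intro sum_mono mult_left_mono) auto
    also have "\<dots> = (\<Sum>k\<in>I. \<Sum>y\<in>words (N * B). ?w k y * (if fails s k y then 1 else 0)) / card I"
      unfolding cI unfolding I_def sum_Times by (simp add: sum_divide_distrib)
    finally show "(\<Sum>m<M. \<Sum>y\<in>words (N * B). joint_MZ pc N B M (code_enc L c) s m y * (if dec y s \<noteq> m then 1 else 0))
      \<le> (\<Sum>k\<in>I. \<Sum>y\<in>words (N * B). ?w k y * (if fails s k y then 1 else 0)) / card I" .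
  qed
  then show ?thesis using that unfolding I_def by blast
qed

lemma ent_scale:
  assumes "0 < a" "sum f A = 1" "\<And>x. x \<in> A \<Longrightarrow> 0 \<le> f x"
  shows "ent A (\<lambda>x. a * f x) = a * ent A f - a * log 2 a"
proof -
  have "(\<Sum>x\<in>A. a * f x * log 2 (a * f x)) = (\<Sum>x\<in>A. a * (f x * log 2 (f x)) + a * log 2 a * f x)"
  proof (intro sum.cong refl)
    fix x assume "x \<in> A"
    then show "a * f x * log 2 (a * f x) = a * (f x * log 2 (f x)) + a * log 2 a * f x"
      using assms by (cases "f x = 0") (auto simp: log_mult less_le algebra_simps)
  qed
  also have "\<dots> = a * (\<Sum>x\<in>A. f x * log 2 (f x)) + a * log 2 a * sum f A"
    by (simp only: sum.distrib sum_distrib_left)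
  finally show ?thesis using assms by (simp add: ent_def)
qed

text \<open>Applied with the eavesdropper's parameters as \<open>pc\<close>. Given the states,
  I(M;Z) = log M + H(Z) - H(M,Z), and H(M,Z) = H(M,L,Z) - H(L|M,Z), where L is the randomisation
  index. Here H(Z) is at most the number of bits, H(M,L,Z) is log M + log L plus the noise entropy,
  and Fano bounds H(L|M,Z).\<close>

lemma leakage_code_enc_le:
  assumes q: "0 \<le> q1" "0 \<le> q2" "q1 + q2 = 1"
    and pc: "0 \<le> pc 1" "pc 1 \<le> 1" "0 \<le> pc 2" "pc 2 \<le> 1"
    and pos: "1 \<le> M" "1 \<le> L"
    and c: "c \<in> PiE ({..<M} \<times> {..<L}) (\<lambda>_. words (N * B))"
  shows "leakage q1 q2 pc N B M (code_enc L c)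
    \<le> real (N * B) + 1 - log 2 L - real (N * B) * (q1 * bH (pc 1) + q2 * bH (pc 2))
      + decoding_cost (N * B) (states B) (state_prob q1 q2) (block_par pc N) T
        ({..<M} \<times> {..<L}) (\<lambda>(m, l). {m} \<times> ({..<L} - {l})) c * log 2 L"
proof -
  define n where "n = N * B"
  define I where "I = {..<M} \<times> {..<L}"
  define fails where "fails s k y \<longleftrightarrow> xor_word (c k) y \<notin> T s
    \<or> (\<exists>j\<in>(\<lambda>(m, l). {m} \<times> ({..<L} - {l})) k. xor_word (c j) y \<in> T s)" for s k y
  define F where "F s = (\<Sum>k\<in>I. \<Sum>y\<in>words n. bsc n (block_par pc N s) (c k) y *
      (if fails s k y then 1 else 0)) / card I" for s
  note enc = valid_code_enc[OF pos c]
  have cI: "real (card I) = real M * real L" by (simp add: I_def card_cartesian_product)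
  have "log 2 M + ent (words n) (\<lambda>z. \<Sum>m<M. joint_MZ pc N B M (code_enc L c) s m z)
       - ent ({..<M} \<times> words n) (\<lambda>(m, z). joint_MZ pc N B M (code_enc L c) s m z)
      \<le> real n + 1 - log 2 L - real N * (\<Sum>b<B. bH (pc (s ! b))) + F s * log 2 L"
    (is "_ + ent _ ?pz - ent _ (\<lambda>(m, z). ?j m z) \<le> _")
    if s: "s \<in> states B" for s
  proof -
    let ?w = "\<lambda>k y. bsc n (block_par pc N s) (c k) y"
    \<comment> \<open>The joint law is arranged for \<open>fano\<close>: the index \<open>l\<close>
      is to be guessed and the pair \<open>(m, z)\<close> is observed. Accordingly the guess
      \<open>d\<close> may use the message.\<close>
    define r where "r l = (\<lambda>(m, z). 1 / (real M * real L) * ?w (m, l) z)" for l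
    define d where "d = (\<lambda>(m, z). SOME l. l < L \<and> xor_word (c (m, l)) z \<in> T s)"
    have bnd: "0 \<le> block_par pc N s i \<and> block_par pc N s i \<le> 1" if "i < n" for i
      using pc that block_par_bounds[OF s, of "\<lambda>p. 0 \<le> p \<and> p \<le> 1"] by (auto simp: n_def)
    then have W0: "0 \<le> ?w k y" for k y by (rule bsc_nonneg)
    have r0: "0 \<le> r l x" for l x using W0 by (auto simp: r_def split: prod.split)
    have r1: "(\<Sum>l<L. \<Sum>x\<in>{..<M} \<times> words n. r l x) = 1"
    proof -
      have "(\<Sum>x\<in>{..<M} \<times> words n. r l x) = 1 / real L" for l
        using pos unfolding r_def
        by (simp add: bsc_sum flip: sum.cartesian_product sum_divide_distrib)
      then show ?thesis using pos by simp
    qed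
    have d: "fails s (m, l) z" if "l < L" "d (m, z) \<noteq> l" for m l z
    proof (rule ccontr)
      assume nf: "\<not> fails s (m, l) z"
      have "(SOME l. l < L \<and> xor_word (c (m, l)) z \<in> T s) = l"
        by (rule some_equality) (use nf that in \<open>auto simp: fails_def\<close>)
      then show False using that by (simp add: d_def)
    qed
    have j_r: "(\<Sum>l<L. r l x) = (\<lambda>(m, z). ?j m z) x" if "x \<in> {..<M} \<times> words n" for x
      using that c by (auto simp: r_def joint_MZ_code_enc n_def)
    have fano: "ent ({..<L} \<times> ({..<M} \<times> words n)) (\<lambda>(l, x). r l x)
          - ent ({..<M} \<times> words n) (\<lambda>x. \<Sum>l<L. r l x)
       \<le> 1 + (\<Sum>l<L. \<Sum>x\<in>{..<M} \<times> words n. r l x * (if d x \<noteq> l then 1 else 0)) * log 2 (card {..<L})"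
      by (rule fano) (use pos r0 r1 in \<open>auto simp: finite_words lessThan_empty_iff\<close>)
    have "(\<Sum>l<L. \<Sum>x\<in>{..<M} \<times> words n. r l x * (if d x \<noteq> l then 1 else 0))
        \<le> (\<Sum>l<L. \<Sum>x\<in>{..<M} \<times> words n. r l x * (if fails s (fst x, l) (snd x) then 1 else 0))"
      using d r0 by (intro sum_mono mult_left_mono) auto
    also have "\<dots> = (\<Sum>l<L. \<Sum>m<M. \<Sum>z\<in>words n.
        1 / (real M * real L) * ?w (m, l) z * (if fails s (m, l) z then 1 else 0))"
      unfolding r_def by (simp add: case_prod_unfold sum.cartesian_product)
    also have "\<dots> = (\<Sum>m<M. \<Sum>l<L. \<Sum>z\<in>words n.
        1 / (real M * real L) * ?w (m, l) z * (if fails s (m, l) z then 1 else 0))"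
      by (rule sum.swap)
    also have "\<dots> = F s"
      unfolding F_def cI unfolding I_def sum_Times by (simp add: sum_divide_distrib)
    finally have dF: "(\<Sum>l<L. \<Sum>x\<in>{..<M} \<times> words n. r l x * (if d x \<noteq> l then 1 else 0)) \<le> F s" .
    have "ent ({..<L} \<times> ({..<M} \<times> words n)) (\<lambda>(l, x). r l x)
        = (\<Sum>l<L. \<Sum>m<M. ent (words n) (\<lambda>z. 1 / (real M * real L) * ?w (m, l) z))"
      unfolding ent_Times r_def ..
    also have "\<dots> = (\<Sum>l<L. \<Sum>m<M. 1 / (real M * real L) * (\<Sum>i<n. bH (block_par pc N s i))
        - 1 / (real M * real L) * log 2 (1 / (real M * real L)))"
    proof (intro sum.cong refl)
      fix m l
      show "ent (words n) (\<lambda>z. 1 / (real M * real L) * ?w (m, l) z)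
        = 1 / (real M * real L) * (\<Sum>i<n. bH (block_par pc N s i))
          - 1 / (real M * real L) * log 2 (1 / (real M * real L))"
        using pos bnd W0 ent_bsc[of n "block_par pc N s" "c (m, l)"]
        by (subst ent_scale) (auto simp: bsc_sum)
    qed
    also have "\<dots> = (\<Sum>i<n. bH (block_par pc N s i)) + log 2 M + log 2 L"
      using pos by (simp add: log_divide log_mult right_diff_distrib field_simps)
    also have "(\<Sum>i<n. bH (block_par pc N s i)) = real N * (\<Sum>b<B. bH (pc (s ! b)))"
      unfolding block_par_def n_def by (rule sum_blocks)
    finally have ent_r: "ent ({..<L} \<times> ({..<M} \<times> words n)) (\<lambda>(l, x). r l x)
        = real N * (\<Sum>b<B. bH (pc (s ! b))) + log 2 M + log 2 L" .
    have ent_j: "ent ({..<M} \<times> words n) (\<lambda>x. \<Sum>l<L. r l x) = ent ({..<M} \<times> words n) (\<lambda>(m, z). ?j m z)"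
      unfolding ent_def by (simp add: j_r cong: sum.cong)
    have "ent (words n) ?pz \<le> log 2 (card (words n))"
    proof (rule ent_le_log_card)
      show "sum ?pz (words n) = 1"
        using sum_joint_MZ[OF enc, of pc s] unfolding n_def by (subst sum.swap)
      show "0 \<le> ?pz z" for z
        using joint_MZ_nonneg[OF enc _ s pc] by (auto intro: sum_nonneg)
    qed (rule finite_words)
    also have "\<dots> = real n" by (simp add: card_words log_nat_power)
    finally have ent_pz: "ent (words n) ?pz \<le> real n" .
    have "(\<Sum>l<L. \<Sum>x\<in>{..<M} \<times> words n. r l x * (if d x \<noteq> l then 1 else 0)) * log 2 L \<le> F s * log 2 L"
      using dF pos by (intro mult_right_mono) auto
    then show ?thesis using fano ent_r ent_j ent_pz by simp
  qed
  then have "leakage q1 q2 pc N B M (code_enc L c) \<le> (\<Sum>s\<in>states B. state_prob q1 q2 s *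
      (real n + 1 - log 2 L - real N * (\<Sum>b<B. bH (pc (s ! b))) + F s * log 2 L))"
    unfolding leakage_eq[OF enc pc] n_def
    by (intro sum_mono mult_left_mono state_prob_nonneg q) auto
  also have "\<dots> = (\<Sum>s\<in>states B. state_prob q1 q2 s) * (real n + 1 - log 2 L)
      - real N * (\<Sum>s\<in>states B. state_prob q1 q2 s * (\<Sum>b<B. bH (pc (s ! b))))
      + (\<Sum>s\<in>states B. state_prob q1 q2 s * F s) * log 2 L"
    by (simp only: distrib_left right_diff_distrib sum.distrib sum_subtractf sum_distrib_left sum_distrib_right)
       (simp add: mult_ac)
  also have "\<dots> = real n + 1 - log 2 L - real n * (q1 * bH (pc 1) + q2 * bH (pc 2))
      + (\<Sum>s\<in>states B. state_prob q1 q2 s * F s) * log 2 L"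
    using state_prob_sum[OF q(3), of B] state_mean[OF q(3), where B = B and g = "\<lambda>j. bH (pc j)"]
    by (simp add: n_def)
  also have "(\<Sum>s\<in>states B. state_prob q1 q2 s * F s)
      = decoding_cost n (states B) (state_prob q1 q2) (block_par pc N) T I (\<lambda>(m, l). {m} \<times> ({..<L} - {l})) c"
    unfolding decoding_cost_def F_def fails_def by simp
  finally show ?thesis unfolding n_def I_def .
qed

subsection \<open>Achievability\<close>

text \<open>Some codebook is no worse than the average of the summed costs, and
  \<open>\<eta>\<close> is its sum, hence a bound for both receivers. The conditions on
  \<open>M\<close> and \<open>L\<close> count rivals, which explains the \<open>- 1\<close>. Against
  typical sets of size at most \<open>2 powr (n * (t + \<delta>))\<close>, with \<open>t\<close>
  equal to \<open>h\<close> or \<open>h'\<close>, they leave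
  \<open>3 * 2 powr (- (n * \<delta>))\<close> and \<open>2 powr (- (n * \<delta>))\<close>,
  together the term with factor 4.\<close>

lemma good_code_exists:
  assumes q: "0 \<le> q1" "0 \<le> q2" "q1 + q2 = 1"
    and pc: "0 \<le> pc 1" "pc 1 \<le> 1" "0 \<le> pc 2" "pc 2 \<le> 1"
    and pce: "0 \<le> pce 1" "pce 1 \<le> 1" "0 \<le> pce 2" "pce 2 \<le> 1"
    and pos: "1 \<le> M" "1 \<le> L" "1 \<le> N" "1 \<le> B" "0 < \<delta>"
  defines "n \<equiv> real (N * B)"
    and "h \<equiv> q1 * bH (pc 1) + q2 * bH (pc 2)"
    and "h' \<equiv> q1 * bH (pce 1) + q2 * bH (pce 2)"
    and "K \<equiv> (\<lambda>(p :: nat \<Rightarrow> real) h. 2 * (bvar (p 1) + bvar (p 2) + q1 * (bH (p 1) - h)\<^sup>2 + q2 * (bH (p 2) - h)\<^sup>2) / \<delta>\<^sup>2)"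
  assumes M: "real (M * L) - 1 \<le> 3 * 2 powr (n * (1 - h - 2 * \<delta>))"
    and L: "real L - 1 \<le> 2 powr (n * (1 - h' - 2 * \<delta>))"
  obtains enc dec \<eta> where "valid_encoder N B M enc" "0 \<le> \<eta>"
    "\<eta> \<le> (K pc h + K pce h') / real B + 4 * 2 powr (- (n * \<delta>))"
    "err_prob q1 q2 pc N B M enc dec \<le> \<eta>"
    "leakage q1 q2 pce N B M enc \<le> n + 1 - log 2 L - n * h' + \<eta> * log 2 L"
proof -
  define I where "I = {..<M} \<times> {..<L}"
  define CB where "CB = PiE I (\<lambda>_. words (N * B))"
  define T where "T p t s = typical_noise (N * B) (block_par p N s) (n * (t + \<delta>))" for p t s
  define cost where "cost p t J c = decoding_cost (N * B) (states B) (state_prob q1 q2) (block_par p N) (T p t) I J c"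
    for p :: "nat \<Rightarrow> real" and t J c
  define J where "J = (\<lambda>(m :: nat, l). {m} \<times> ({..<L} - {l}))"
  have pw: "(2::real) ^ (N * B) = 2 powr n" by (simp add: n_def powr_realpow del: of_nat_mult)
  have finI: "finite I" "I \<noteq> {}" using pos by (auto simp: I_def lessThan_empty_iff)
  have finCB: "finite CB" "CB \<noteq> {}"
    using finI card_words[of "N * B"] by (auto simp: CB_def PiE_eq_empty_iff finite_words intro!: finite_PiE)
  \<comment> \<open>One estimate for both receivers: used with \<open>a = 3\<close> and all other
    codewords as rivals for the legitimate one, with \<open>a = 1\<close> and the codewords of the
    same message for the eavesdropper.\<close>
  have gen: "(\<Sum>c\<in>CB. cost p t J' c) \<le> card CB * (K p t / real B + a * 2 powr (- (n * \<delta>)))"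
    if p: "0 \<le> p 1" "p 1 \<le> 1" "0 \<le> p 2" "p 2 \<le> 1"
      and t: "t = q1 * bH (p 1) + q2 * bH (p 2)"
      and J': "\<And>k. k \<in> I \<Longrightarrow> J' k \<subseteq> I - {k}"
        "\<And>k. k \<in> I \<Longrightarrow> real (card (J' k)) \<le> a * 2 powr (n * (1 - t - 2 * \<delta>))"
    for p :: "nat \<Rightarrow> real" and t J' a
  proof -
    have bnd: "0 \<le> block_par p N s i \<and> block_par p N s i \<le> 1" if "s \<in> states B" "i < N * B" for s i
      using p that block_par_bounds[OF that(1), of "\<lambda>p. 0 \<le> p \<and> p \<le> 1"] by auto
    have "(\<Sum>c\<in>CB. cost p t J' c) \<le> card CB *
      ((\<Sum>s\<in>states B. state_prob q1 q2 s * (\<Sum>e\<in>words (N * B).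
          bsc (N * B) (block_par p N s) (zero_word (N * B)) e * (if e \<notin> T p t s then 1 else 0)))
       + (a * 2 powr (n * (1 - t - 2 * \<delta>))) * 2 powr (n * (t + \<delta>)) / 2 ^ (N * B))"
      unfolding cost_def CB_def
    proof (rule sum_decoding_cost_le[OF finI finite_states J'])
      show "real (card (T p t s)) \<le> 2 powr (n * (t + \<delta>))" if "s \<in> states B" for s
        unfolding T_def by (rule card_typical_noise) (use bnd[OF that] in auto)
    qed (use q bnd in \<open>auto simp: T_def finite_typical_noise state_prob_nonneg state_prob_sum\<close>)
    also have "\<dots> \<le> card CB * (K p t / real B + a * 2 powr (- (n * \<delta>)))"
    proof (intro mult_left_mono add_mono)
      show "(\<Sum>s\<in>states B. state_prob q1 q2 s * (\<Sum>e\<in>words (N * B).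
          bsc (N * B) (block_par p N s) (zero_word (N * B)) e * (if e \<notin> T p t s then 1 else 0)))
          \<le> K p t / real B"
        unfolding T_def K_def t n_def
        by (rule atypical_noise_bound) (use q p pos in auto)
      have "2 powr (n * (1 - t - 2 * \<delta>)) * 2 powr (n * (t + \<delta>)) = 2 powr (- (n * \<delta>)) * (2::real) ^ (N * B)"
        unfolding pw powr_add[symmetric] by (simp add: algebra_simps)
      then show "(a * 2 powr (n * (1 - t - 2 * \<delta>))) * 2 powr (n * (t + \<delta>)) / 2 ^ (N * B)
          \<le> a * 2 powr (- (n * \<delta>))"
        by (simp add: mult.assoc)
    qed simp
    finally show ?thesis .
  qed
  have "(\<Sum>c\<in>CB. cost pc h (\<lambda>k. I - {k}) c + cost pce h' J c)
      \<le> (\<Sum>c\<in>CB. (K pc h + K pce h') / real B + 4 * 2 powr (- (n * \<delta>)))"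
  proof -
    have "(\<Sum>c\<in>CB. cost pc h (\<lambda>k. I - {k}) c) \<le> card CB * (K pc h / real B + 3 * 2 powr (- (n * \<delta>)))"
    proof (rule gen[OF pc h_def[THEN meta_eq_to_obj_eq]])
      fix k assume "k \<in> I"
      then have "card (I - {k}) = M * L - 1" using finI by (simp add: I_def card_cartesian_product)
      then show "real (card (I - {k})) \<le> 3 * 2 powr (n * (1 - h - 2 * \<delta>))"
        using M pos by (simp add: of_nat_diff)
    qed simp
    moreover have "(\<Sum>c\<in>CB. cost pce h' J c) \<le> card CB * (K pce h' / real B + 1 * 2 powr (- (n * \<delta>)))"
    proof (rule gen[OF pce h'_def[THEN meta_eq_to_obj_eq]])
      fix k assume k: "k \<in> I"
      then have "card (J k) = L - 1" by (auto simp: I_def J_def card_cartesian_product)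
      then show "real (card (J k)) \<le> 1 * 2 powr (n * (1 - h' - 2 * \<delta>))"
        using L pos by (simp add: of_nat_diff)
      show "J k \<subseteq> I - {k}" using k by (auto simp: I_def J_def)
    qed
    ultimately show ?thesis by (simp add: sum.distrib algebra_simps add_divide_distrib)
  qed
  then have "\<exists>c\<in>CB. cost pc h (\<lambda>k. I - {k}) c + cost pce h' J c
      \<le> (K pc h + K pce h') / real B + 4 * 2 powr (- (n * \<delta>))"
    using sum_strict_mono[OF finCB, of "\<lambda>_. (K pc h + K pce h') / real B + 4 * 2 powr (- (n * \<delta>))"
        "\<lambda>c. cost pc h (\<lambda>k. I - {k}) c + cost pce h' J c"]
    by (meson not_le)
  then obtain c where c: "c \<in> CB" and cost_le: "cost pc h (\<lambda>k. I - {k}) c + cost pce h' J c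
      \<le> (K pc h + K pce h') / real B + 4 * 2 powr (- (n * \<delta>))" by blast
  have cost0: "0 \<le> cost p t J' c" if "0 \<le> p 1" "p 1 \<le> 1" "0 \<le> p 2" "p 2 \<le> 1" for p :: "nat \<Rightarrow> real" and t J'
    unfolding cost_def decoding_cost_def
  proof (intro sum_nonneg divide_nonneg_nonneg mult_nonneg_nonneg state_prob_nonneg q)
    fix s k y assume "s \<in> states B"
    then show "0 \<le> bsc (N * B) (block_par p N s) (c k) y"
      by (intro bsc_nonneg) (use that block_par_bounds[of s B "\<lambda>p. 0 \<le> p \<and> p \<le> 1"] in auto)
  qed auto
  let ?\<eta> = "cost pc h (\<lambda>k. I - {k}) c + cost pce h' J c"
  have cI: "c \<in> PiE ({..<M} \<times> {..<L}) (\<lambda>_. words (N * B))" using c by (simp add: CB_def I_def)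
  obtain dec where "err_prob q1 q2 pc N B M (code_enc L c) dec \<le> cost pc h (\<lambda>k. I - {k}) c"
    using err_prob_code_enc_le[OF q(1,2) pc cI] unfolding cost_def I_def .
  then have err: "err_prob q1 q2 pc N B M (code_enc L c) dec \<le> ?\<eta>"
    using cost0[OF pce, of h' J] by linarith
  have "leakage q1 q2 pce N B M (code_enc L c) \<le> n + 1 - log 2 L - n * h' + cost pce h' J c * log 2 L"
    unfolding n_def h'_def cost_def I_def J_def by (rule leakage_code_enc_le[OF q pce pos(1,2) cI])
  also have "\<dots> \<le> n + 1 - log 2 L - n * h' + ?\<eta> * log 2 L"
    using cost0[OF pc, of h "\<lambda>k. I - {k}"] pos by (intro add_left_mono mult_right_mono) auto
  finally show ?thesis
    using that[OF valid_code_enc[OF pos(1,2) cI] _ cost_le err] cost0 pc pce by (simp add: add_nonneg_nonneg)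
qed

lemma achievability_step:
  assumes q: "0 \<le> q1" "0 \<le> q2" "q1 + q2 = 1"
    and p: "0 \<le> pc 1" "pc 1 \<le> pce 1" "pce 1 \<le> 1 / 2" "0 \<le> pc 2" "pc 2 \<le> pce 2" "pce 2 \<le> 1 / 2"
    and \<epsilon>: "0 < \<epsilon>"
  shows "\<exists>N B M enc dec. k \<le> N \<and> k \<le> B \<and> valid_encoder N B M enc
     \<and> log 2 (real M) / real (N * B) \<ge> q1 * (bH (pce 1) - bH (pc 1)) + q2 * (bH (pce 2) - bH (pc 2)) - \<epsilon>
     \<and> err_prob q1 q2 pc N B M enc dec \<le> \<epsilon>
     \<and> leakage q1 q2 pce N B M enc / real (N * B) \<le> \<epsilon>"
proof -
  \<comment> \<open>The budget: \<open>3 * \<delta> < \<epsilon>\<close> is lost in rate. The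
    leakage per symbol is at most \<open>1 / n + 2 * \<delta> + 2 * \<eta>\<close>, and the three
    terms are bounded by \<open>\<epsilon> / 4\<close>, \<open>\<epsilon> / 4\<close> and
    \<open>\<epsilon> / 2\<close>.\<close>
  define \<delta> where "\<delta> = \<epsilon> / 8"
  define h where "h = q1 * bH (pc 1) + q2 * bH (pc 2)"
  define h' where "h' = q1 * bH (pce 1) + q2 * bH (pce 2)"
  define K where "K = (\<lambda>(p :: nat \<Rightarrow> real) h. 2 * (bvar (p 1) + bvar (p 2) + q1 * (bH (p 1) - h)\<^sup>2 + q2 * (bH (p 2) - h)\<^sup>2) / \<delta>\<^sup>2)"
  have \<delta>: "0 < \<delta>" using \<epsilon> by (simp add: \<delta>_def)
  have h: "h \<le> h'" unfolding h_def h'_def using q p by (intro add_mono mult_left_mono bH_mono) auto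
  have h'1: "h' \<le> 1"
  proof -
    have "h' \<le> q1 * 1 + q2 * 1" unfolding h'_def using q p
      by (intro add_mono mult_left_mono bH_le_1) auto
    then show ?thesis using q by simp
  qed
  have h'0: "0 \<le> h'" unfolding h'_def using q p
    by (intro add_nonneg_nonneg mult_nonneg_nonneg bH_nonneg) auto
  have "(\<lambda>t. (K pc h + K pce h') / real t) \<longlonglongrightarrow> 0" by (rule lim_const_over_n)
  then have ev1: "eventually (\<lambda>t. (K pc h + K pce h') / real t < \<epsilon> / 8) sequentially"
    by (rule order_tendstoD) (use \<epsilon> in simp)
  have "(\<lambda>t. 1 / real t) \<longlonglongrightarrow> 0" by (rule lim_const_over_n)
  then have ev2: "eventually (\<lambda>t. 1 / real t < \<epsilon> / 4) sequentially"
    by (rule order_tendstoD) (use \<epsilon> in simp)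
  have "(\<lambda>t. (2 powr (- \<delta>)) ^ t :: real) \<longlonglongrightarrow> 0"
    by (rule LIMSEQ_power_zero) (use \<delta> in \<open>simp add: powr_less_one\<close>)
  then have ev3: "eventually (\<lambda>t. (2 powr (- \<delta>)) ^ t < \<epsilon> / 32) sequentially"
    by (rule order_tendstoD) (use \<epsilon> in simp)
  obtain t where t: "(K pc h + K pce h') / real t < \<epsilon> / 8" "1 / real t < \<epsilon> / 4"
      "(2 powr (- \<delta>)) ^ t < \<epsilon> / 32" "k \<le> t" "1 \<le> t"
    using eventually_happens'[OF sequentially_bot eventually_conj[OF ev1 eventually_conj[OF ev2
          eventually_conj[OF ev3 eventually_conj[OF eventually_ge_at_top[of k] eventually_ge_at_top[of 1]]]]]]
    by blast
  \<comment> \<open>Block length and number of blocks are both \<open>t\<close>.\<close>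
  define n where "n = real (t * t)"
  have nt: "real t \<le> n" using t(5) by (simp add: n_def)
  have n1: "1 \<le> n" using nt t(5) by linarith
  define a where "a = 2 powr (n * (h' - h - 3 * \<delta>))"
  define b where "b = 2 powr (n * (1 - h' - 2 * \<delta>))"
  \<comment> \<open>The exponents may be negative, for example that of \<open>b\<close> when
    \<open>h' = 1\<close>. Rounding up still gives at least one message and one index.\<close>
  define M where "M = nat \<lceil>a\<rceil>"
  define L where "L = nat \<lceil>b\<rceil>"
  have ab: "0 < a" "0 < b" by (simp_all add: a_def b_def)
  have M1: "1 \<le> M" and L1: "1 \<le> L" using ab by (auto simp: M_def L_def Suc_le_eq)
  have Mb: "a \<le> real M" "real M \<le> a + 1" and Lb: "b \<le> real L" "real L \<le> b + 1"
    using ab unfolding M_def L_def by linarith+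
  \<comment> \<open>Rounding leaves \<open>(a + 1) * (b + 1) - 1 = a * b + a + b\<close>, and each
    summand is at most the target power; hence the factor 3. The bound on \<open>a\<close> uses
    \<open>h' \<le> 1\<close>, that on \<open>b\<close> uses \<open>h \<le> h'\<close>.\<close>
  have Mcond: "real (M * L) - 1 \<le> 3 * 2 powr (n * (1 - h - 2 * \<delta>))"
  proof -
    let ?r = "2 powr (n * (1 - h - 2 * \<delta>))"
    have "real (M * L) \<le> (a + 1) * (b + 1)"
      unfolding of_nat_mult using Mb Lb ab by (intro mult_mono) auto
    then have "real (M * L) - 1 \<le> a * b + a + b" by (simp add: algebra_simps)
    moreover have "a \<le> ?r" unfolding a_def
      using h'1 \<delta> n1 by (intro powr_mono mult_left_mono) auto
    moreover have "b \<le> ?r" unfolding b_def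
      using h n1 by (intro powr_mono mult_left_mono) auto
    moreover have "a * b \<le> ?r" unfolding a_def b_def powr_add[symmetric] distrib_left[symmetric]
      using \<delta> n1 by (intro powr_mono mult_left_mono) auto
    ultimately show ?thesis by linarith
  qed
  have Lcond: "real L - 1 \<le> 2 powr (n * (1 - h' - 2 * \<delta>))" using Lb by (simp add: b_def)
  have pc1: "0 \<le> pc 1" "pc 1 \<le> 1" "0 \<le> pc 2" "pc 2 \<le> 1"
    and pce1: "0 \<le> pce 1" "pce 1 \<le> 1" "0 \<le> pce 2" "pce 2 \<le> 1" using p by auto
  obtain enc dec \<eta> where enc: "valid_encoder t t M enc" and \<eta>0: "0 \<le> \<eta>"
    and \<eta>: "\<eta> \<le> (K pc h + K pce h') / real t + 4 * 2 powr (- (n * \<delta>))"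
    and err: "err_prob q1 q2 pc t t M enc dec \<le> \<eta>"
    and leak: "leakage q1 q2 pce t t M enc \<le> n + 1 - log 2 L - n * h' + \<eta> * log 2 L"
    by (rule good_code_exists[OF q pc1 pce1 M1 L1 t(5,5) \<delta> Mcond[unfolded n_def h_def] Lcond[unfolded n_def h'_def]])
       (auto simp: n_def h_def h'_def K_def)
  have "2 powr (- (n * \<delta>)) \<le> 2 powr (real t * (- \<delta>))"
    using nt \<delta> by (intro powr_mono) auto
  also have "\<dots> = (2 powr (- \<delta>)) ^ t" by (simp add: powr_powr mult.commute flip: powr_realpow)
  finally have \<eta>_small: "\<eta> \<le> \<epsilon> / 4" using \<eta> t by linarith
  have logM: "n * (h' - h - 3 * \<delta>) \<le> log 2 M"
    using Mb(1) ab M1 unfolding a_def by (simp add: le_log_iff)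
  have logL: "n * (1 - h' - 2 * \<delta>) \<le> log 2 L"
    using Lb(1) ab L1 unfolding b_def by (simp add: le_log_iff)
  \<comment> \<open>A crude linear bound suffices because it is multiplied by \<open>\<eta>\<close>;
    the factor 2 absorbs the rounding.\<close>
  have logL': "log 2 L \<le> 2 * n"
  proof -
    have "b \<le> 2 powr n" unfolding b_def using h'0 \<delta> n1 by (intro powr_mono) (auto simp: mult_le_cancel_left1)
    moreover have "1 \<le> 2 powr n" using n1 by (simp add: ge_one_powr_ge_zero)
    ultimately have "real L \<le> 2 powr 1 * 2 powr n" using Lb by simp
    also have "\<dots> \<le> 2 powr (2 * n)" unfolding powr_add[symmetric] using n1 by (intro powr_mono) auto
    finally show ?thesis using L1 by (simp add: log_le_iff)
  qed
  have "leakage q1 q2 pce t t M enc \<le> n + 1 - n * (1 - h' - 2 * \<delta>) - n * h' + \<epsilon> / 4 * (2 * n)"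
    using leak logL mult_mono[OF \<eta>_small logL'] L1 \<epsilon> by simp
  also have "\<dots> = 1 + n * (3 * \<epsilon> / 4)" by (simp add: \<delta>_def algebra_simps)
  finally have "leakage q1 q2 pce t t M enc / n \<le> (1 + n * (3 * \<epsilon> / 4)) / n"
    using n1 by (intro divide_right_mono) auto
  also have "\<dots> = 1 / n + 3 * \<epsilon> / 4" using n1 by (simp add: field_simps)
  also have "\<dots> \<le> \<epsilon>"
  proof -
    have "1 / n \<le> 1 / real t" using nt t(5) by (intro divide_left_mono) auto
    then show ?thesis using t(2) by linarith
  qed
  finally have leak_le: "leakage q1 q2 pce t t M enc / n \<le> \<epsilon>" .
  have "h' - h - 3 * \<delta> \<le> log 2 M / n" using logM n1 by (simp add: pos_le_divide_eq mult.commute)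
  moreover have "h' - h = q1 * (bH (pce 1) - bH (pc 1)) + q2 * (bH (pce 2) - bH (pc 2))"
    by (simp add: h_def h'_def algebra_simps)
  ultimately have "q1 * (bH (pce 1) - bH (pc 1)) + q2 * (bH (pce 2) - bH (pc 2)) - \<epsilon> \<le> log 2 M / n"
    using \<epsilon> by (simp add: \<delta>_def)
  moreover have "err_prob q1 q2 pc t t M enc dec \<le> \<epsilon>" using err \<eta>_small \<epsilon> by linarith
  ultimately show ?thesis using enc leak_le t(4) unfolding n_def by blast
qed

lemma achievability:
  assumes q: "0 \<le> q1" "0 \<le> q2" "q1 + q2 = 1"
    and p: "0 \<le> pc 1" "pc 1 \<le> pce 1" "pce 1 \<le> 1 / 2" "0 \<le> pc 2" "pc 2 \<le> pce 2" "pce 2 \<le> 1 / 2"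
  shows "sec_achievable q1 q2 pc pce (q1 * (bH (pce 1) - bH (pc 1)) + q2 * (bH (pce 2) - bH (pc 2)))"
    (is "sec_achievable _ _ _ _ ?C")
proof -
  \<comment> \<open>Diagonal choice: the code at stage \<open>k\<close> has slack 1/(k+1) in rate,
    error and leakage, and both lengths are at least \<open>k\<close>.\<close>
  have "\<forall>k. \<exists>N B M enc dec. k \<le> N \<and> k \<le> B \<and> valid_encoder N B M enc
     \<and> log 2 (real M) / real (N * B) \<ge> ?C - inverse (real (Suc k))
     \<and> err_prob q1 q2 pc N B M enc dec \<le> inverse (real (Suc k))
     \<and> leakage q1 q2 pce N B M enc / real (N * B) \<le> inverse (real (Suc k))"
    by (intro allI achievability_step[OF q p]) simp
  then obtain N B M enc dec where
    *: "\<And>k. k \<le> N k \<and> k \<le> B k \<and> valid_encoder (N k) (B k) (M k) (enc k)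
     \<and> log 2 (real (M k)) / real (N k * B k) \<ge> ?C - inverse (real (Suc k))
     \<and> err_prob q1 q2 pc (N k) (B k) (M k) (enc k) (dec k) \<le> inverse (real (Suc k))
     \<and> leakage q1 q2 pce (N k) (B k) (M k) (enc k) / real (N k * B k) \<le> inverse (real (Suc k))"
    by metis
  show ?thesis
    unfolding sec_achievable_def
  proof (intro exI conjI allI impI)
    show "filterlim N at_top sequentially" "filterlim B at_top sequentially"
      using * by (auto intro!: filterlim_at_top_mono[OF filterlim_ident] always_eventually)
    show "valid_encoder (N k) (B k) (M k) (enc k)" for k using * by blast
    show "eventually (\<lambda>k. ?C - \<epsilon> \<le> log 2 (real (M k)) / real (N k * B k)) sequentially"
      if "0 < \<epsilon>" for \<epsilon> :: real
      using order_tendstoD(2)[OF LIMSEQ_inverse_real_of_nat that]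
    proof eventually_elim
      case (elim k)
      then show ?case using *[of k] by linarith
    qed
    show "(\<lambda>k. err_prob q1 q2 pc (N k) (B k) (M k) (enc k) (dec k)) \<longlonglongrightarrow> 0"
      by (rule tendsto_sandwich[OF _ _ tendsto_const LIMSEQ_inverse_real_of_nat])
         (use * q p in \<open>auto intro!: always_eventually err_prob_nonneg\<close>)
    show "(\<lambda>k. leakage q1 q2 pce (N k) (B k) (M k) (enc k) / real (N k * B k)) \<longlonglongrightarrow> 0"
      by (rule tendsto_sandwich[OF _ _ tendsto_const LIMSEQ_inverse_real_of_nat])
         (use * q p in \<open>auto intro!: always_eventually divide_nonneg_nonneg leakage_nonneg simp del: of_nat_mult\<close>)
  qed
qed

theorem theorem1:
  fixes q1 q2 p1 p2 p1s p2s :: real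
  assumes "0 \<le> q1" "q1 \<le> 1" "q2 = 1 - q1"
    and "0 \<le> p1" "p1 \<le> p2" "p2 \<le> p1s" "p1s \<le> p2s" "p2s \<le> 1/2"
  shows "sec_capacity_CSID q1 q2 p1 p2 p1s p2s
           = q1 * (bH p1s - bH p1) + q2 * (bH p2s - bH p2)"
  unfolding sec_capacity_CSID_def
\<comment> \<open>The supremum is attained: \<open>sec_achievable\<close> lets the rate fall short
  by any positive amount, so the capacity value itself is achievable.\<close>
proof (rule cSup_eq_maximum)
  let ?pc = "\<lambda>j::nat. if j = 1 then p1 else p2" and ?pce = "\<lambda>j::nat. if j = 1 then p1s else p2s"
  show "q1 * (bH p1s - bH p1) + q2 * (bH p2s - bH p2) \<in> {R. sec_achievable q1 q2 ?pc ?pce R}"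
    using achievability[of q1 q2 ?pc ?pce] assms by simp
  show "R \<le> q1 * (bH p1s - bH p1) + q2 * (bH p2s - bH p2)"
    if "R \<in> {R. sec_achievable q1 q2 ?pc ?pce R}" for R
    using converse_rate[of q1 q2 ?pc ?pce R] that assms by simp
qed

end
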